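(* Let $G$ be a countable abelian group and let $A, B \subset G$. Then for all integers $0 < j < k$ we have $$d^*(A^jB) \geq d^*(A^k)^{j/k}\, d^{*}(B)^{1-j/k}$$ and $$d_*(A^jB) \geq d^*(A^k)^{j/k}\, d_{*}(B)^{1-j/k}.$$
   Context: The group is written multiplicatively. For subsets $A,B$ of $G$, $AB=\{ab : a\in A, b\in B\}$, and $A^1=A$, $A^k=A^{k-1}A$ for $k>1$ (iterated product sets). A Følner sequence in a countable group $G$ is a sequence $(F_n)_{n\in\mathbb{N}}$ of finite (non-empty) subsets of $G$ such that $\lim_{n\to\infty} |F_n\cap gF_n|/|F_n| = 1$ for each $g\in G$. Every countable abelian group has a Følner sequence. For a Følner sequence $(F_n)$ and $A\subset G$ put $\overline{d}_{(F_n)}(A)=\limsup_{n\to\infty} |F_n\cap A|/|F_n|$. The upper Banach density $d^*(A)$ (resp. lower Banach density $d_*(A)$) is the maximum (resp. minimum) of the set $\{\overline{d}_{(F_n)}(A) : (F_n)_{n\in\mathbb{N}} \text{ is a Følner sequence in } G\}$; these extrema are attained. *)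

theory Defs
  imports "HOL-Algebra.Coset" "HOL-Library.Extended_Real" "HOL-Library.Countable_Set"
begin

(* Only positive exponents are meaningful; the value at 0 is a convention. *)
fun set_power :: "('a, 'b) monoid_scheme \<Rightarrow> 'a set \<Rightarrow> nat \<Rightarrow> 'a set" where
  "set_power G A 0 = {\<one>\<^bsub>G\<^esub>}"
| "set_power G A (Suc 0) = A"
| "set_power G A (Suc (Suc n)) = set_power G A (Suc n) <#>\<^bsub>G\<^esub> A"

definition folner_sequence :: "('a, 'b) monoid_scheme \<Rightarrow> (nat \<Rightarrow> 'a set) \<Rightarrow> bool" where
  "folner_sequence G F \<longleftrightarrow>
     (\<forall>n. finite (F n) \<and> F n \<noteq> {} \<and> F n \<subseteq> carrier G) \<and>
     (\<forall>g \<in> carrier G.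
        (\<lambda>n. real (card (F n \<inter> (g <#\<^bsub>G\<^esub> F n))) / real (card (F n))) \<longlonglongrightarrow> 1)"

(* The limit superior is taken in the extended reals, where it always exists; along a Folner
   sequence it lies between 0 and 1, so the conversion back to the reals is faithful. *)
definition upper_density :: "(nat \<Rightarrow> 'a set) \<Rightarrow> 'a set \<Rightarrow> real" where
  "upper_density F A =
     real_of_ereal (limsup (\<lambda>n. ereal (real (card (F n \<inter> A)) / real (card (F n)))))"

(* Maximum and minimum of the same set of upper densities; in a countable group possessing a
   Folner sequence (in particular in every countable abelian group) both are attained, so that
   they agree with the supremum and infimum. *)
definition upper_banach_density :: "('a, 'b) monoid_scheme \<Rightarrow> 'a set \<Rightarrow> real" where
  "upper_banach_density G A =
     (GREATEST d. d \<in> {upper_density F A | F. folner_sequence G F})"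

definition lower_banach_density :: "('a, 'b) monoid_scheme \<Rightarrow> 'a set \<Rightarrow> real" where
  "lower_banach_density G A =
     (LEAST d. d \<in> {upper_density F A | F. folner_sequence G F})"

end

theory Submission
  imports Defs
begin

text \<open>
The proof is finite combinatorics on large almost invariant sets. Write \<open>D = A^j B\<close> and
\<open>c = d^*(A^k)\<close>.

Both Banach densities can be read off finite windows: \<open>d^*(D)\<close> is the infimum, over the finite
nonempty sets \<open>H\<close>, of the largest relative density of \<open>D\<close> in a translate of \<open>H\<close>, and \<open>d_*(D)\<close> is
the supremum of the smallest one (\<open>upper_banach_density_characterization\<close>,
\<open>lower_banach_density_characterization\<close>). In particular the extrema in their definitions are
attained.

Let \<open>a\<close> be \<open>d^*(D)\<close> or \<open>d_*(D)\<close>, and take a very invariant finite set \<open>F\<close> in which \<open>D\<close> has relative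
density about \<open>a\<close> and \<open>B\<close> about \<open>\<beta>\<close>. For a finite part \<open>A'\<close> of \<open>A\<close> the set \<open>A'^j (B \<inter> F)\<close> has at most
about \<open>a |F|\<close> elements. Whenever \<open>C^j \<beta> > a\<close>, Pluennecke's inequality therefore yields
\<open>X \<subseteq> B \<inter> F\<close> with \<open>|A'^k X| \<le> C^k |X|\<close>, and \<open>X\<close> can be taken to be a fixed proportion of \<open>F\<close>
(\<open>plunnecke_exhaustion\<close>). Thicken \<open>X\<close> along a rapidly growing sequence of finite sets \<open>E_0, E_1, ...\<close>
and let \<open>H_i\<close> be an almost \<open>E_i\<close>-invariant window in which \<open>A^k\<close> has density at least \<open>c\<close>. Since
\<open>E_i X\<close> stays almost inside \<open>F\<close>, its size cannot keep growing by a constant factor, so some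
\<open>Z = E_i X\<close> is almost invariant under \<open>H_i\<close>. Averaging over the translates of \<open>H_i\<close> by elements of \<open>Z\<close> shows that \<open>A'^k X\<close> has at
least about \<open>c |Z|\<close> elements (\<open>card_set_mult_ge_of_windows\<close>). Hence \<open>c |Z|\<close> is at most about
\<open>C^k |X| \<le> C^k |B \<inter> Z|\<close>: the density of \<open>B\<close> in \<open>Z\<close> is at least about \<open>c / C^k\<close>. The density of \<open>D\<close> in
\<open>Z\<close> is still at most about \<open>a\<close>. For \<open>a = d^*(D)\<close> every sufficiently invariant set has this property;
for \<open>a = d_*(D)\<close> it holds because \<open>D\<close> cannot have density below \<open>a\<close> in the rest of \<open>F\<close>.

So a pair \<open>(a, \<beta>)\<close> of simultaneously realised densities may be replaced by \<open>(a, c / C^k)\<close>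
(\<open>density_increment\<close>). Choosing \<open>\<beta>\<close> maximal for the given \<open>a\<close> forces \<open>c \<le> C^k \<beta>\<close> for every
\<open>C > (a / \<beta>)^(1/j)\<close>, that is, \<open>a \<ge> c^(j/k) \<beta>^(1-j/k)\<close>; and the maximal \<open>\<beta>\<close> is at least
\<open>d^*(B)\<close>, respectively \<open>d_*(B)\<close>. This maximality does the work that an ergodic decomposition would do
in a measure-theoretic argument.

Pluennecke's inequality is needed for arbitrary exponents \<open>j < k\<close>, not only for \<open>j = 1\<close>. It is
obtained by the method of weighted cuts of Petridis. In the layered graph with layers
\<open>B, A B, ..., A^k B\<close>, give a vertex of layer \<open>i\<close> the weight \<open>1 / C^i\<close>. If \<open>|A^k X| \<ge> C^k |X|\<close> for
all \<open>X \<subseteq> B\<close>, then every set of vertices that meets all paths from bottom to top weighs at least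
\<open>|B|\<close>, and the cut \<open>A^j B\<close> in layer \<open>j\<close> gives \<open>|A^j B| \<ge> C^j |B|\<close>.
\<close>

section \<open>Pluennecke's inequality by weighted cuts\<close>

lemma sum_nat_layers:
  fixes f :: "'b \<Rightarrow> nat"
  assumes "finite S" "\<And>v. v \<in> S \<Longrightarrow> f v \<le> M"
  shows "(\<Sum>v\<in>S. f v) = (\<Sum>t=1..M. card {v \<in> S. t \<le> f v})"
proof -
  have "(\<Sum>v\<in>S. f v) = (\<Sum>v\<in>S. \<Sum>t=1..M. if t \<le> f v then 1 else 0)"
  proof (rule sum.cong[OF refl])
    fix v assume "v \<in> S"
    then have "{t \<in> {1..M}. t \<le> f v} = {1..f v}" using assms(2) by force
    then show "f v = (\<Sum>t=1..M. if t \<le> f v then 1 else 0)"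
      by (simp add: sum.inter_filter[symmetric])
  qed
  also have "\<dots> = (\<Sum>t=1..M. \<Sum>v\<in>S. if t \<le> f v then 1 else 0)" by (rule sum.swap)
  also have "\<dots> = (\<Sum>t=1..M. card {v \<in> S. t \<le> f v})"
    using assms(1) by (simp add: sum.inter_filter[symmetric])
  finally show ?thesis .
qed

text \<open>
Both sums are integrals over the levels \<open>t \<ge> 1\<close> of the sizes of the superlevel sets, so the
hypothesis bounds the difference level by level. The contribution of \<open>t = 1\<close> is kept on the left: with
degrees for \<open>f\<close> and \<open>g\<close> it counts vertices, whereas the sums on the right count edges.
\<close>
lemma layered_comparison:
  fixes f :: "'b \<Rightarrow> nat" and g :: "'c \<Rightarrow> nat" and C :: real
  assumes fin: "finite S" "finite T"
    and levels: "\<And>t. t \<ge> 1 \<Longrightarrow>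
      C * real (card {v \<in> S. t \<le> f v}) \<le> real (card {w \<in> T. t \<le> g w})"
  shows "real (card {w \<in> T. 1 \<le> g w}) - C * real (card {v \<in> S. 1 \<le> f v})
         \<le> real (\<Sum>w\<in>T. g w) - C * real (\<Sum>v\<in>S. f v)"
proof -
  define M where "M = Suc (sum f S + sum g T)"
  define d where "d t = real (card {w \<in> T. t \<le> g w}) - C * real (card {v \<in> S. t \<le> f v})" for t
  have fM: "f v \<le> M" if "v \<in> S" for v
    using member_le_sum[OF that, of f] fin by (simp add: M_def)
  have gM: "g w \<le> M" if "w \<in> T" for w
    using member_le_sum[OF that, of g] fin by (simp add: M_def)
  have fsum: "(\<Sum>v\<in>S. f v) = (\<Sum>t=1..M. card {v \<in> S. t \<le> f v})"
    by (rule sum_nat_layers[OF fin(1) fM])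
  have gsum: "(\<Sum>w\<in>T. g w) = (\<Sum>t=1..M. card {w \<in> T. t \<le> g w})"
    by (rule sum_nat_layers[OF fin(2) gM])
  have "real (\<Sum>w\<in>T. g w) - C * real (\<Sum>v\<in>S. f v) = (\<Sum>t=1..M. d t)"
    unfolding fsum gsum d_def by (simp only: of_nat_sum sum_subtractf sum_distrib_left)
  moreover have "d 1 \<le> (\<Sum>t=1..M. d t)"
    by (rule member_le_sum) (use levels in \<open>auto simp: d_def M_def\<close>)
  ultimately show ?thesis by (simp add: d_def)
qed

context comm_group
begin

lemma finite_set_mult: "finite A \<Longrightarrow> finite X \<Longrightarrow> finite (A <#> X)"
  by (auto simp: set_mult_def)

lemma set_mult_memI: "a \<in> A \<Longrightarrow> x \<in> X \<Longrightarrow> a \<otimes> x \<in> A <#> X"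
  by (auto simp: set_mult_def)

lemma set_mult_memE:
  assumes "z \<in> A <#> X" obtains a x where "a \<in> A" "x \<in> X" "z = a \<otimes> x"
  using assms by (auto simp: set_mult_def)

lemma set_mult_comm: "A \<subseteq> carrier G \<Longrightarrow> X \<subseteq> carrier G \<Longrightarrow> A <#> X = X <#> A"
  by (auto simp: set_mult_def subset_iff) (metis m_comm)+

lemma one_set_mult: "X \<subseteq> carrier G \<Longrightarrow> {\<one>} <#> X = X"
  by (auto simp: set_mult_def subset_iff)

lemma set_power_Suc:
  "A \<subseteq> carrier G \<Longrightarrow> set_power G A (Suc n) = set_power G A n <#> A"
  by (cases n) (auto simp: one_set_mult)

lemma set_power_subset_carrier: "A \<subseteq> carrier G \<Longrightarrow> set_power G A n \<subseteq> carrier G"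
  by (induction n) (simp_all add: set_power_Suc set_mult_closed del: set_power.simps(2,3))

lemma finite_set_power: "A \<subseteq> carrier G \<Longrightarrow> finite A \<Longrightarrow> finite (set_power G A n)"
  by (induction n) (auto simp: set_power_Suc intro!: finite_set_mult simp del: set_power.simps(2,3))

lemma set_power_mono:
  assumes "A \<subseteq> A'" "A' \<subseteq> carrier G" shows "set_power G A n \<subseteq> set_power G A' n"
proof (induction n)
  case (Suc n)
  have "A \<subseteq> carrier G" using assms by blast
  then show ?case
    using mono_set_mult[OF Suc assms(1), of G] by (simp only: set_power_Suc assms)
qed simp

lemma set_mult_set_power:
  assumes "A \<subseteq> carrier G" "X \<subseteq> carrier G"
  shows "A <#> (set_power G A n <#> X) = set_power G A (Suc n) <#> X"
  using assms set_power_subset_carrier[OF assms(1), of n]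
  by (simp add: set_power_Suc set_mult_assoc[symmetric] set_mult_comm[of A "set_power G A n"]
      del: set_power.simps(2,3))

lemma inv_mult_cancel: "a \<in> carrier G \<Longrightarrow> v \<in> carrier G \<Longrightarrow> inv a \<otimes> (a \<otimes> v) = v"
  by (simp add: m_assoc[symmetric])

lemma mult_inv_cancel: "a \<in> carrier G \<Longrightarrow> v \<in> carrier G \<Longrightarrow> a \<otimes> (inv a \<otimes> v) = v"
  by (simp add: m_assoc[symmetric])

text \<open>
Both sides count the edges from \<open>S\<close> to \<open>T\<close> in the graph joining \<open>v\<close> to \<open>a \<otimes> v\<close> for \<open>a \<in> A\<close>.
\<close>
lemma edge_double_count:
  assumes "finite A" "finite S" "finite T" "A \<subseteq> carrier G" "S \<subseteq> carrier G" "T \<subseteq> carrier G"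
  shows "(\<Sum>v\<in>S. card {a \<in> A. a \<otimes> v \<in> T}) = (\<Sum>w\<in>T. card {a \<in> A. inv a \<otimes> w \<in> S})"
proof -
  have "(\<Sum>v\<in>S. card {a \<in> A. a \<otimes> v \<in> T}) = card (SIGMA v:S. {a \<in> A. a \<otimes> v \<in> T})"
    using assms by (subst card_SigmaI) auto
  also have "\<dots> = card (SIGMA w:T. {a \<in> A. inv a \<otimes> w \<in> S})"
  proof (rule bij_betw_same_card[of "\<lambda>(v, a). (a \<otimes> v, a)"],
      rule bij_betw_byWitness[where f' = "\<lambda>(w, a). (inv a \<otimes> w, a)"])
  qed (use assms in \<open>auto simp: subset_iff inv_mult_cancel mult_inv_cancel\<close>)
  also have "\<dots> = (\<Sum>w\<in>T. card {a \<in> A. inv a \<otimes> w \<in> S})"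
    using assms by (subst card_SigmaI) auto
  finally show ?thesis .
qed

text \<open>
Here \<open>U\<close> and \<open>V\<close> are the reachable parts of two consecutive layers and \<open>S\<close> is the part of the cut
between them. The hypotheses \<open>up\<close> and \<open>down\<close> say that moving any part of \<open>S\<close> one layer up, or one
layer down, does not decrease the weight of the cut; the conclusion says that moving all of \<open>S\<close> up
does not increase it.

Because the group is commutative, the path \<open>u, a u, b a u\<close> can be rerouted as \<open>u, b u, b a u\<close>, and
the new middle vertex lies in \<open>S\<close> as well. Hence in-degrees grow along the edges from \<open>S\<close> upwards
and out-degrees grow along the edges downwards. Comparing the superlevel sets of the degrees through
\<open>up\<close> and \<open>down\<close>, the number of edges leaving \<open>S\<close> is at least \<open>C\<close> times the number entering it, and
also at most \<open>C\<close> times that number. So there is no slack at level 1 of the degrees, which is the claim.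
\<close>
lemma channel_exchange:
  fixes C :: real
  assumes fin: "finite A" "finite U" "finite S"
    and sub: "A \<subseteq> carrier G" "U \<subseteq> carrier G" "V \<subseteq> carrier G"
    and S: "S = (A <#> U) - V" and C: "C > 0"
    and up: "\<And>Y. Y \<subseteq> S \<Longrightarrow> C * real (card Y) \<le> real (card ((A <#> Y) - (A <#> V)))"
    and down: "\<And>Y. Y \<subseteq> S \<Longrightarrow> real (card Y) \<le> C * real (card {u \<in> U. \<exists>a\<in>A. a \<otimes> u \<in> Y})"
  shows "real (card ((A <#> S) - (A <#> V))) \<le> C * real (card S)"
proof -
  define T where "T = (A <#> S) - (A <#> V)"
  have SG: "S \<subseteq> carrier G" using S set_mult_closed[OF sub(1,2)] by blast
  have TG: "T \<subseteq> carrier G" using set_mult_closed[OF sub(1) SG] unfolding T_def by blast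
  have finT: "finite T" using finite_set_mult fin by (auto simp: T_def)
  define out where "out v = card {a \<in> A. a \<otimes> v \<in> T}" for v
  define inS where "inS w = card {a \<in> A. inv a \<otimes> w \<in> S}" for w
  define inU where "inU v = card {a \<in> A. inv a \<otimes> v \<in> U}" for v
  define outU where "outU u = card {a \<in> A. a \<otimes> u \<in> S}" for u
  \<comment> \<open>Rerouting: an edge entering \<open>v\<close> from \<open>U\<close> with label \<open>b\<close> gives an edge with label \<open>b\<close> from \<open>S\<close> into \<open>a \<otimes> v\<close>.\<close>
  have inS_mono: "inU v \<le> inS (a \<otimes> v)" if "v \<in> S" "a \<in> A" "a \<otimes> v \<in> T" for v a
    unfolding inS_def inU_def
  proof (rule card_mono)
    show "{b \<in> A. inv b \<otimes> v \<in> U} \<subseteq> {b \<in> A. inv b \<otimes> (a \<otimes> v) \<in> S}"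
    proof (intro subsetI, clarify)
      fix b assume b: "b \<in> A" "inv b \<otimes> v \<in> U"
      have car: "a \<in> carrier G" "b \<in> carrier G" "v \<in> carrier G" using that b sub SG by auto
      have eq: "inv b \<otimes> (a \<otimes> v) = a \<otimes> (inv b \<otimes> v)" using car by (simp add: m_lcomm)
      have undo: "b \<otimes> (a \<otimes> (inv b \<otimes> v)) = a \<otimes> v"
        using car by (metis inv_closed m_closed m_lcomm mult_inv_cancel)
      have "a \<otimes> (inv b \<otimes> v) \<in> A <#> U" using b that by (auto intro: set_mult_memI)
      moreover have "a \<otimes> (inv b \<otimes> v) \<notin> V"
        using set_mult_memI[of b A "a \<otimes> (inv b \<otimes> v)" V] undo b that by (auto simp: T_def)
      ultimately show "inv b \<otimes> (a \<otimes> v) \<in> S" by (simp add: eq S)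
    qed
  qed (use fin in auto)
  \<comment> \<open>Rerouting: an edge leaving \<open>a \<otimes> u\<close> upwards with label \<open>b\<close> gives an edge with label \<open>b\<close> from \<open>u\<close> into \<open>S\<close>.\<close>
  have outU_mono: "out (a \<otimes> u) \<le> outU u" if "u \<in> U" "a \<in> A" "a \<otimes> u \<in> S" for u a
    unfolding out_def outU_def
  proof (rule card_mono)
    show "{b \<in> A. b \<otimes> (a \<otimes> u) \<in> T} \<subseteq> {b \<in> A. b \<otimes> u \<in> S}"
    proof (intro subsetI, clarify)
      fix b assume b: "b \<in> A" "b \<otimes> (a \<otimes> u) \<in> T"
      have car: "a \<in> carrier G" "b \<in> carrier G" "u \<in> carrier G" using that b sub by auto
      have "b \<otimes> u \<in> A <#> U" using b that by (auto intro: set_mult_memI)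
      moreover have "b \<otimes> u \<notin> V"
        using set_mult_memI[of a A "b \<otimes> u" V] m_lcomm[of a b u] b that car by (auto simp: T_def)
      ultimately show "b \<otimes> u \<in> S" by (simp add: S)
    qed
  qed (use fin in auto)
  have "real (card {w \<in> T. 1 \<le> inS w}) - C * real (card {v \<in> S. 1 \<le> inU v})
        \<le> real (\<Sum>w\<in>T. inS w) - C * real (\<Sum>v\<in>S. inU v)"
  proof (rule layered_comparison[OF fin(3) finT])
    fix t :: nat
    have "(A <#> {v \<in> S. t \<le> inU v}) - (A <#> V) \<subseteq> {w \<in> T. t \<le> inS w}"
    proof
      fix w assume w: "w \<in> (A <#> {v \<in> S. t \<le> inU v}) - (A <#> V)"
      then obtain a v where av: "a \<in> A" "v \<in> S" "t \<le> inU v" "w = a \<otimes> v"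
        by (auto elim: set_mult_memE)
      then have "w \<in> T" using w by (auto simp: T_def intro: set_mult_memI)
      then show "w \<in> {w \<in> T. t \<le> inS w}" using inS_mono[of v a] av by auto
    qed
    then have "card ((A <#> {v \<in> S. t \<le> inU v}) - (A <#> V)) \<le> card {w \<in> T. t \<le> inS w}"
      using finT by (intro card_mono) auto
    then show "C * real (card {v \<in> S. t \<le> inU v}) \<le> real (card {w \<in> T. t \<le> inS w})"
      using up[of "{v \<in> S. t \<le> inU v}"] by force
  qed
  moreover have "{w \<in> T. 1 \<le> inS w} = T"
  proof (intro equalityI subsetI, simp)
    fix w assume w: "w \<in> T"
    then obtain a v where av: "a \<in> A" "v \<in> S" "w = a \<otimes> v" by (auto simp: T_def elim: set_mult_memE)
    then have "inv a \<otimes> w \<in> S" using sub SG by (simp add: inv_mult_cancel subset_iff)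
    then have "0 < inS w" using av fin unfolding inS_def by (subst card_gt_0_iff) auto
    then show "w \<in> {w \<in> T. 1 \<le> inS w}" using w by auto
  qed
  moreover have "{v \<in> S. 1 \<le> inU v} \<subseteq> S" by auto
  then have "C * real (card {v \<in> S. 1 \<le> inU v}) \<le> C * real (card S)"
    using C fin by (intro mult_left_mono) (auto intro: card_mono)
  ultimately have one: "real (card T) - C * real (card S)
      \<le> real (\<Sum>w\<in>T. inS w) - C * real (\<Sum>v\<in>S. inU v)" by simp
  have "real (card {u \<in> U. 1 \<le> outU u}) - 1 / C * real (card {v \<in> S. 1 \<le> out v})
        \<le> real (\<Sum>u\<in>U. outU u) - 1 / C * real (\<Sum>v\<in>S. out v)"
  proof (rule layered_comparison[OF fin(3,2)])
    fix t :: nat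
    have "{u \<in> U. \<exists>a\<in>A. a \<otimes> u \<in> {v \<in> S. t \<le> out v}} \<subseteq> {u \<in> U. t \<le> outU u}"
      using outU_mono by (auto intro: order_trans)
    then have "card {u \<in> U. \<exists>a\<in>A. a \<otimes> u \<in> {v \<in> S. t \<le> out v}} \<le> card {u \<in> U. t \<le> outU u}"
      using fin by (intro card_mono) auto
    then have "C * real (card {u \<in> U. \<exists>a\<in>A. a \<otimes> u \<in> {v \<in> S. t \<le> out v}})
        \<le> C * real (card {u \<in> U. t \<le> outU u})" using C by simp
    then show "1 / C * real (card {v \<in> S. t \<le> out v}) \<le> real (card {u \<in> U. t \<le> outU u})"
      using down[of "{v \<in> S. t \<le> out v}"] C
      by (auto simp: pos_divide_le_eq mult.commute intro: order_trans)
  qed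
  moreover have "real (card {v \<in> S. 1 \<le> out v}) \<le> C * real (card {u \<in> U. 1 \<le> outU u})"
  proof -
    have "{u \<in> U. \<exists>a\<in>A. a \<otimes> u \<in> {v \<in> S. 1 \<le> out v}} \<subseteq> {u \<in> U. 1 \<le> outU u}"
      using outU_mono by (auto intro: order_trans)
    then have "card {u \<in> U. \<exists>a\<in>A. a \<otimes> u \<in> {v \<in> S. 1 \<le> out v}} \<le> card {u \<in> U. 1 \<le> outU u}"
      using fin by (intro card_mono) auto
    then have "C * real (card {u \<in> U. \<exists>a\<in>A. a \<otimes> u \<in> {v \<in> S. 1 \<le> out v}})
        \<le> C * real (card {u \<in> U. 1 \<le> outU u})" using C by simp
    then show ?thesis using down[of "{v \<in> S. 1 \<le> out v}"] by auto
  qed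
  moreover have "q \<le> C * p" if "r - 1 / C * d \<le> p - 1 / C * q" "d \<le> C * r" for r d p q :: real
  proof -
    have "C * (r - 1 / C * d) \<le> C * (p - 1 / C * q)" using that C by simp
    then show ?thesis using that C by (simp add: right_diff_distrib)
  qed
  ultimately have two: "real (\<Sum>v\<in>S. out v) \<le> C * real (\<Sum>u\<in>U. outU u)"
    by blast
  have "(\<Sum>v\<in>S. out v) = (\<Sum>w\<in>T. inS w)"
    unfolding out_def inS_def by (rule edge_double_count) (use fin finT sub SG TG in auto)
  moreover have "(\<Sum>u\<in>U. outU u) = (\<Sum>v\<in>S. inU v)"
    unfolding outU_def inU_def by (rule edge_double_count) (use fin sub SG in auto)
  ultimately show ?thesis using one two by (simp add: T_def)
qed


text \<open>
A cut is described by the sets \<open>R i\<close> of vertices in layer \<open>i\<close> that remain reachable from layer 0. The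
frontier of layer \<open>i\<close> consists of the vertices that can be entered from layer \<open>i - 1\<close> (all of \<open>B\<close> for
\<open>i = 0\<close>), so the vertices of layer \<open>i\<close> that the cut has to contain are the frontier minus \<open>R i\<close>. The
chains are not required to satisfy \<open>R (Suc i) \<subseteq> A <#> R i\<close>; this leaves room to shrink one layer
without touching the next.
\<close>
definition cut_frontier :: "'a set \<Rightarrow> 'a set \<Rightarrow> (nat \<Rightarrow> 'a set) \<Rightarrow> nat \<Rightarrow> 'a set" where
  "cut_frontier A B R i = (case i of 0 \<Rightarrow> B | Suc l \<Rightarrow> A <#> R l)"

definition cut_weight :: "'a set \<Rightarrow> 'a set \<Rightarrow> real \<Rightarrow> nat \<Rightarrow> (nat \<Rightarrow> 'a set) \<Rightarrow> real" where
  "cut_weight A B C k R = (\<Sum>i\<le>k. real (card (cut_frontier A B R i - R i)) / C ^ i)"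

definition reach_chains :: "'a set \<Rightarrow> 'a set \<Rightarrow> nat \<Rightarrow> (nat \<Rightarrow> 'a set) set" where
  "reach_chains A B k =
     {R. (\<forall>i<k. R i \<subseteq> set_power G A i <#> B) \<and> (\<forall>i\<ge>k. R i = {})}"

text \<open>
A change of one layer affects the cut in that layer and in the next one only.
\<close>
lemma cut_weight_update:
  assumes "m < k"
  shows "cut_weight A B C k (R(m := V)) - cut_weight A B C k R
       = (real (card (cut_frontier A B R m - V)) - real (card (cut_frontier A B R m - R m))) / C ^ m
       + (real (card ((A <#> V) - R (Suc m))) - real (card ((A <#> R m) - R (Suc m)))) / C ^ Suc m"
proof -
  let ?d = "\<lambda>i. real (card (cut_frontier A B (R(m := V)) i - (R(m := V)) i)) / C ^ i
      - real (card (cut_frontier A B R i - R i)) / C ^ i"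
  have "cut_weight A B C k (R(m := V)) - cut_weight A B C k R = (\<Sum>i\<le>k. ?d i)"
    by (simp add: cut_weight_def sum_subtractf)
  also have "\<dots> = (\<Sum>i\<in>{m, Suc m}. ?d i)"
  proof (rule sum.mono_neutral_right)
    show "\<forall>i\<in>{..k} - {m, Suc m}. ?d i = 0"
    proof
      fix i assume "i \<in> {..k} - {m, Suc m}"
      then show "?d i = 0" by (cases i) (auto simp: cut_frontier_def)
    qed
  qed (use assms in auto)
  also have "\<dots> = ?d m + ?d (Suc m)" by simp
  also have "?d m = (real (card (cut_frontier A B R m - V)) - real (card (cut_frontier A B R m - R m))) / C ^ m"
    by (cases m) (simp_all add: cut_frontier_def diff_divide_distrib)
  also have "?d (Suc m) = (real (card ((A <#> V) - R (Suc m))) - real (card ((A <#> R m) - R (Suc m)))) / C ^ Suc m"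
    by (simp add: cut_frontier_def diff_divide_distrib)
  finally show ?thesis .
qed

lemma finite_reach_chains:
  assumes "finite A" "finite B" "A \<subseteq> carrier G"
  shows "finite (reach_chains A B k)"
proof (rule finite_subset)
  let ?U = "\<Union>i<k. set_power G A i <#> B"
  show "reach_chains A B k \<subseteq> {R. \<forall>i. (i \<in> {..<k} \<longrightarrow> R i \<in> Pow ?U) \<and> (i \<notin> {..<k} \<longrightarrow> R i = {})}"
    by (auto simp: reach_chains_def)
  show "finite {R. \<forall>i. (i \<in> {..<k} \<longrightarrow> R i \<in> Pow ?U) \<and> (i \<notin> {..<k} \<longrightarrow> R i = {})}"
    by (rule finite_set_of_finite_funs) (use assms in \<open>auto intro!: finite_set_mult finite_set_power\<close>)
qed

lemma reach_chains_subset_carrier: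
  assumes "R \<in> reach_chains A B k" "A \<subseteq> carrier G" "B \<subseteq> carrier G"
  shows "R i \<subseteq> carrier G"
proof (cases "i < k")
  case True
  then have "R i \<subseteq> set_power G A i <#> B" using assms by (auto simp: reach_chains_def)
  then show ?thesis using set_mult_closed[OF set_power_subset_carrier[OF assms(2)] assms(3)] by blast
qed (use assms in \<open>auto simp: reach_chains_def\<close>)

lemma reach_chains_finite:
  assumes "R \<in> reach_chains A B k" "finite A" "finite B" "A \<subseteq> carrier G"
  shows "finite (R i)"
proof (cases "i < k")
  case True
  then have "R i \<subseteq> set_power G A i <#> B" using assms by (auto simp: reach_chains_def)
  then show ?thesis using assms finite_set_mult finite_set_power finite_subset by metis
qed (use assms in \<open>auto simp: reach_chains_def\<close>)

text \<open>
If a minimal cut is pushed from layer \<open>i + 1\<close> to layer \<open>i + 2\<close> it stays minimal. Minimality against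
enlarging \<open>R (i + 1)\<close> and against shrinking \<open>R i\<close> supplies the two hypotheses of
\<open>channel_exchange\<close>.
\<close>
lemma minimal_cut_push_up:
  fixes C :: real
  assumes fin: "finite A" "finite B" and sub: "A \<subseteq> carrier G" "B \<subseteq> carrier G"
    and C: "C > 0" and ik: "Suc i < k"
    and R: "R \<in> reach_chains A B k"
    and minR: "\<And>R'. R' \<in> reach_chains A B k \<Longrightarrow> cut_weight A B C k R \<le> cut_weight A B C k R'"
  defines "R' \<equiv> R(Suc i := R (Suc i) \<union> (A <#> R i))"
  shows "R' \<in> reach_chains A B k" and "cut_weight A B C k R' \<le> cut_weight A B C k R"
proof -
  define U where "U = R i"
  define V where "V = R (Suc i)"
  define S where "S = (A <#> U) - V"
  note Rcar = reach_chains_subset_carrier[OF R sub]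
  note Rfin = reach_chains_finite[OF R fin sub(1)]
  have finU: "finite U" and finV: "finite V" using Rfin by (auto simp: U_def V_def)
  have finS: "finite S" using finU fin finite_set_mult by (simp add: S_def)
  have Rl: "R l \<subseteq> set_power G A l <#> B" if "l < k" for l
    using R that by (auto simp: reach_chains_def)
  have "A <#> R i \<subseteq> A <#> (set_power G A i <#> B)"
    by (rule mono_set_mult) (use Rl[of i] ik in auto)
  then have AU: "A <#> U \<subseteq> set_power G A (Suc i) <#> B"
    by (simp add: U_def set_mult_set_power sub del: set_power.simps)
  have empty: "R l = {}" if "l \<ge> k" for l
    using R that unfolding reach_chains_def by blast
  have grow: "R(Suc i := V \<union> Y) \<in> reach_chains A B k" if "Y \<subseteq> S" for Y
  proof -
    have "V \<union> Y \<subseteq> set_power G A (Suc i) <#> B"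
      using AU that Rl[OF ik] unfolding V_def S_def by blast
    then show ?thesis
      unfolding reach_chains_def using Rl empty ik by (auto simp del: set_power.simps)
  qed
  have shrink: "R(i := U - N) \<in> reach_chains A B k" for N
  proof -
    have "U - N \<subseteq> set_power G A i <#> B" using Rl[of i] ik unfolding U_def by fastforce
    then show ?thesis unfolding reach_chains_def using Rl empty ik by auto
  qed
  have grow_weight: "cut_weight A B C k (R(Suc i := V \<union> Y)) - cut_weight A B C k R
      \<le> - real (card Y) / C ^ Suc i + real (card ((A <#> Y) - (A <#> V))) / C ^ Suc (Suc i)"
    if Y: "Y \<subseteq> S" for Y
  proof -
    have finY: "finite Y" using Y finS finite_subset by blast
    have "card ((A <#> U) - (V \<union> Y)) = card (S - Y)"
      by (rule arg_cong[of _ _ card]) (auto simp: S_def)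
    also have "\<dots> = card S - card Y" using Y finY by (simp add: card_Diff_subset)
    finally have a: "real (card ((A <#> U) - (V \<union> Y))) - real (card ((A <#> U) - V)) = - real (card Y)"
      using card_mono[OF finS Y] by (simp add: S_def)
    have "(A <#> (V \<union> Y)) - R (Suc (Suc i)) \<subseteq> ((A <#> V) - R (Suc (Suc i))) \<union> ((A <#> Y) - (A <#> V))"
      by (auto simp: set_mult_def)
    then have "card ((A <#> (V \<union> Y)) - R (Suc (Suc i)))
        \<le> card (((A <#> V) - R (Suc (Suc i))) \<union> ((A <#> Y) - (A <#> V)))"
      by (rule card_mono[rotated]) (simp add: finite_set_mult fin finV finY)
    also have "\<dots> \<le> card ((A <#> V) - R (Suc (Suc i))) + card ((A <#> Y) - (A <#> V))"
      by (rule card_Un_le)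
    finally have b: "real (card ((A <#> (V \<union> Y)) - R (Suc (Suc i)))) - real (card ((A <#> V) - R (Suc (Suc i))))
        \<le> real (card ((A <#> Y) - (A <#> V)))" by linarith
    show ?thesis
      using cut_weight_update[OF ik, of A B C R "V \<union> Y"] a divide_right_mono[OF b, of "C ^ Suc (Suc i)"] C
      by (simp add: cut_frontier_def U_def V_def)
  qed
  have up: "C * real (card Y) \<le> real (card ((A <#> Y) - (A <#> V)))" if Y: "Y \<subseteq> S" for Y
  proof -
    have "real (card Y) / C ^ Suc i \<le> real (card ((A <#> Y) - (A <#> V))) / C ^ Suc (Suc i)"
      using minR[OF grow[OF Y]] grow_weight[OF Y] by linarith
    then show ?thesis using C by (simp add: field_simps)
  qed
  have down: "real (card Y) \<le> C * real (card {u \<in> U. \<exists>a\<in>A. a \<otimes> u \<in> Y})" if Y: "Y \<subseteq> S" for Y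
  proof -
    define N where "N = {u \<in> U. \<exists>a\<in>A. a \<otimes> u \<in> Y}"
    have finY: "finite Y" using Y finS finite_subset by blast
    have finN: "finite N" using finU by (simp add: N_def)
    have "card (cut_frontier A B R i - (U - N)) \<le> card ((cut_frontier A B R i - U) \<union> N)"
    proof (rule card_mono)
      have "finite (cut_frontier A B R i)"
        using fin Rfin by (cases i) (auto simp: cut_frontier_def finite_set_mult)
      then show "finite ((cut_frontier A B R i - U) \<union> N)" using finN by simp
    qed auto
    also have "\<dots> \<le> card (cut_frontier A B R i - U) + card N" by (rule card_Un_le)
    finally have a: "real (card (cut_frontier A B R i - (U - N))) - real (card (cut_frontier A B R i - U)) \<le> real (card N)"
      by linarith
    have "(A <#> (U - N)) - V \<subseteq> S - Y"
      by (auto simp: set_mult_def S_def N_def)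
    then have "card ((A <#> (U - N)) - V) \<le> card (S - Y)" using finS by (intro card_mono) auto
    also have "\<dots> = card S - card Y" using Y finY by (simp add: card_Diff_subset)
    finally have b: "real (card ((A <#> (U - N)) - V)) - real (card ((A <#> U) - V)) \<le> - real (card Y)"
      using card_mono[OF finS Y] by (simp add: S_def)
    have "0 \<le> cut_weight A B C k (R(i := U - N)) - cut_weight A B C k R"
      using minR[OF shrink] by simp
    also have "\<dots> = (real (card (cut_frontier A B R i - (U - N))) - real (card (cut_frontier A B R i - U))) / C ^ i
       + (real (card ((A <#> (U - N)) - V)) - real (card ((A <#> U) - V))) / C ^ Suc i"
      using cut_weight_update[of i k A B C R "U - N"] ik by (simp add: U_def V_def)
    also have "\<dots> \<le> real (card N) / C ^ i + (- real (card Y)) / C ^ Suc i"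
      using C by (intro add_mono divide_right_mono a b) auto
    finally show ?thesis using C by (simp add: field_simps N_def)
  qed
  have "real (card ((A <#> S) - (A <#> V))) \<le> C * real (card S)"
    by (rule channel_exchange[OF fin(1) finU finS sub(1) _ _ S_def C up down])
      (use Rcar in \<open>auto simp: U_def V_def\<close>)
  then have "real (card ((A <#> S) - (A <#> V))) / C ^ Suc (Suc i) \<le> real (card S) / C ^ Suc i"
    using C by (simp add: field_simps)
  moreover have R': "R' = R(Suc i := V \<union> S)"
    by (auto simp: R'_def V_def S_def U_def fun_eq_iff)
  ultimately show "cut_weight A B C k R' \<le> cut_weight A B C k R" using grow_weight[of S] by simp
  show "R' \<in> reach_chains A B k" using grow[of S] R' by simp
qed

text \<open>
A minimal cut can be pushed up layer by layer until it lies in layers 0 and \<open>k\<close> only. Then it contains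
\<open>B - M 0\<close> and all of \<open>A^k (M 0)\<close>, and the hypothesis \<open>top\<close> bounds its weight.
\<close>
theorem cut_weight_lower_bound:
  fixes C :: real
  assumes fin: "finite A" "finite B" and sub: "A \<subseteq> carrier G" "B \<subseteq> carrier G"
    and C: "C > 0" and k: "k > 0"
    and top: "\<And>X. X \<subseteq> B \<Longrightarrow> C ^ k * real (card X) \<le> real (card (set_power G A k <#> X))"
    and R: "R \<in> reach_chains A B k"
  shows "real (card B) \<le> cut_weight A B C k R"
proof -
  let ?w = "cut_weight A B C k"
  have filled: "\<exists>M \<in> reach_chains A B k. (\<forall>R' \<in> reach_chains A B k. ?w M \<le> ?w R')
      \<and> (\<forall>l<i. A <#> M l \<subseteq> M (Suc l))" if "i < k" for i
    using that
  proof (induction i)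
    case 0
    have "reach_chains A B k \<noteq> {}" using R by auto
    then obtain M where "is_arg_min ?w (\<lambda>M. M \<in> reach_chains A B k) M"
      using ex_is_arg_min_if_finite[OF finite_reach_chains[OF fin sub(1)]] by blast
    then show ?case by (auto simp: is_arg_min_linorder)
  next
    case (Suc i)
    then obtain M where M: "M \<in> reach_chains A B k" "\<And>R'. R' \<in> reach_chains A B k \<Longrightarrow> ?w M \<le> ?w R'"
      and fill: "\<And>l. l < i \<Longrightarrow> A <#> M l \<subseteq> M (Suc l)" by force
    let ?M = "M(Suc i := M (Suc i) \<union> (A <#> M i))"
    have "?M \<in> reach_chains A B k" "?w ?M \<le> ?w M"
      using minimal_cut_push_up[OF fin sub C Suc.prems M] by auto
    moreover have "A <#> ?M l \<subseteq> ?M (Suc l)" if "l < Suc i" for l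
      using that fill[of l] by (auto simp: less_Suc_eq)
    ultimately show ?case using M(2) by (meson order_trans)
  qed
  obtain n where n: "k = Suc n" using k by (cases k) auto
  obtain M where M: "M \<in> reach_chains A B k" "\<And>R'. R' \<in> reach_chains A B k \<Longrightarrow> ?w M \<le> ?w R'"
    and fill: "\<And>l. l < n \<Longrightarrow> A <#> M l \<subseteq> M (Suc l)" using filled[of n] n by auto
  note Mcar = reach_chains_subset_carrier[OF M(1) sub]
  note Mfin = reach_chains_finite[OF M(1) fin sub(1)]
  have "M 0 \<subseteq> set_power G A 0 <#> B" using M(1) k unfolding reach_chains_def by blast
  then have M0: "M 0 \<subseteq> B" using sub by (simp add: one_set_mult)
  have below: "set_power G A l <#> M 0 \<subseteq> M l" if "l \<le> n" for l
    using that
  proof (induction l)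
    case 0
    then show ?case by (simp add: one_set_mult Mcar)
  next
    case (Suc l)
    have "set_power G A (Suc l) <#> M 0 = A <#> (set_power G A l <#> M 0)"
      by (rule set_mult_set_power[symmetric]) (use sub Mcar in auto)
    also have "\<dots> \<subseteq> A <#> M l" by (rule mono_set_mult) (use Suc in auto)
    also have "\<dots> \<subseteq> M (Suc l)" using fill Suc.prems by simp
    finally show ?case .
  qed
  have "set_power G A k <#> M 0 = A <#> (set_power G A n <#> M 0)"
    unfolding n by (rule set_mult_set_power[symmetric]) (use sub Mcar in auto)
  also have "\<dots> \<subseteq> A <#> M n" by (rule mono_set_mult) (use below in auto)
  finally have "card (set_power G A k <#> M 0) \<le> card (A <#> M n)"
    using Mfin fin by (intro card_mono finite_set_mult) auto
  then have "C ^ k * real (card (M 0)) \<le> real (card (A <#> M n))" using top[OF M0] by linarith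
  then have last: "real (card (M 0)) \<le> real (card (A <#> M n)) / C ^ k"
    using C by (simp add: field_simps)
  have "real (card B) = real (card (B - M 0)) + real (card (M 0))"
    using M0 fin Mfin by (simp add: card_Diff_subset card_mono)
  also have "\<dots> \<le> real (card (B - M 0)) + real (card (A <#> M n)) / C ^ k" using last by simp
  also have "\<dots> = (\<Sum>i\<in>{0, k}. real (card (cut_frontier A B M i - M i)) / C ^ i)"
    using M(1) n by (simp add: cut_frontier_def reach_chains_def)
  also have "\<dots> \<le> ?w M"
    unfolding cut_weight_def using C by (intro sum_mono2) auto
  also have "\<dots> \<le> ?w R" by (rule M(2)[OF R])
  finally show ?thesis .
qed

text \<open>
The lower bound for cuts is applied to the cut that consists of the whole layer \<open>j\<close>.
\<close>
theorem plunnecke_growth: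
  fixes C :: real
  assumes fin: "finite A" "finite B" and sub: "A \<subseteq> carrier G" "B \<subseteq> carrier G"
    and C: "C > 0" and jk: "0 < j" "j < k"
    and top: "\<And>X. X \<subseteq> B \<Longrightarrow> C ^ k * real (card X) \<le> real (card (set_power G A k <#> X))"
  shows "C ^ j * real (card B) \<le> real (card (set_power G A j <#> B))"
proof -
  define R where "R i = (if i < j then set_power G A i <#> B else {})" for i
  have "R \<in> reach_chains A B k" using jk by (auto simp: reach_chains_def R_def)
  then have "real (card B) \<le> cut_weight A B C k R"
    using cut_weight_lower_bound[OF fin sub C _ top] jk by simp
  also have "cut_weight A B C k R = (\<Sum>i\<in>{j}. real (card (cut_frontier A B R i - R i)) / C ^ i)"
    unfolding cut_weight_def
  proof (rule sum.mono_neutral_right)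
    show "\<forall>i\<in>{..k} - {j}. real (card (cut_frontier A B R i - R i)) / C ^ i = 0"
    proof
      fix i assume i: "i \<in> {..k} - {j}"
      have "cut_frontier A B R i - R i = {}"
      proof (cases i)
        case 0
        then show ?thesis using jk sub by (simp add: cut_frontier_def R_def one_set_mult)
      next
        case (Suc l)
        have "cut_frontier A B R i = A <#> R l" by (simp add: Suc cut_frontier_def)
        also have "\<dots> = (if l < j then set_power G A i <#> B else {})"
          unfolding R_def Suc using set_mult_set_power[OF sub] by (auto simp: set_mult_def)
        finally show ?thesis using i Suc by (simp add: R_def)
      qed
      from arg_cong[OF this, of card] have "card (cut_frontier A B R i - R i) = 0"
        unfolding card.empty .
      then show "real (card (cut_frontier A B R i - R i)) / C ^ i = 0" by simp
    qed
  qed (use jk in auto)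
  finally have "real (card B) \<le> real (card (cut_frontier A B R j - R j)) / C ^ j" by simp
  moreover have "cut_frontier A B R j - R j = set_power G A j <#> B"
    using jk sub by (cases j) (auto simp: cut_frontier_def R_def set_mult_set_power simp del: set_power.simps)
  ultimately show ?thesis using C by (simp only:) (simp add: field_simps)
qed

text \<open>
Pluennecke's inequality with control on the size of \<open>X\<close>. For a largest \<open>X\<close> of small growth, no
nonempty subset of \<open>B - X\<close> has small growth, since it could be added to \<open>X\<close>; so
\<open>plunnecke_growth\<close> applies to \<open>B - X\<close>.
\<close>
theorem plunnecke_exhaustion:
  fixes C :: real
  assumes fin: "finite A" "finite B" and sub: "A \<subseteq> carrier G" "B \<subseteq> carrier G"
    and C: "C > 0" and jk: "0 < j" "j < k"
  shows "\<exists>X\<subseteq>B. real (card (set_power G A k <#> X)) \<le> C ^ k * real (card X) \<and>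
    C ^ j * (real (card B) - real (card X)) \<le> real (card (set_power G A j <#> B))"
proof -
  define P where "P X \<longleftrightarrow> X \<subseteq> B \<and> real (card (set_power G A k <#> X)) \<le> C ^ k * real (card X)" for X
  have "P {}" by (simp add: P_def set_mult_def)
  moreover have "\<forall>Z. P Z \<longrightarrow> card Z < Suc (card B)"
    using fin by (auto simp: P_def less_Suc_eq_le intro: card_mono)
  ultimately have "\<exists>X. P X \<and> (\<forall>Z. P Z \<longrightarrow> card Z \<le> card X)"
    by (rule ex_has_greatest_nat[of P "{}" card "Suc (card B)"])
  then obtain X where X: "P X" and max: "\<And>Z. P Z \<Longrightarrow> card Z \<le> card X" by blast
  have XB: "X \<subseteq> B" and XP: "real (card (set_power G A k <#> X)) \<le> C ^ k * real (card X)"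
    using X by (simp_all add: P_def)
  have finX: "finite X" using XB fin finite_subset by blast
  have top: "C ^ k * real (card Y) \<le> real (card (set_power G A k <#> Y))" if Y: "Y \<subseteq> B - X" for Y
  proof (rule ccontr)
    assume "\<not> ?thesis"
    then have less: "real (card (set_power G A k <#> Y)) < C ^ k * real (card Y)" by linarith
    then have ne: "Y \<noteq> {}" by auto
    have finY: "finite Y" using Y fin finite_subset by blast
    have card: "card (X \<union> Y) = card X + card Y" using Y finX finY by (intro card_Un_disjoint) auto
    have "set_power G A k <#> (X \<union> Y) = (set_power G A k <#> X) \<union> (set_power G A k <#> Y)"
      by (auto simp: set_mult_def)
    then have "card (set_power G A k <#> (X \<union> Y)) \<le> card (set_power G A k <#> X) + card (set_power G A k <#> Y)"
      by (simp only: card_Un_le)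
    then have "real (card (set_power G A k <#> (X \<union> Y)))
        \<le> real (card (set_power G A k <#> X)) + real (card (set_power G A k <#> Y))" by linarith
    also have "\<dots> \<le> C ^ k * real (card X) + C ^ k * real (card Y)"
      using XP less by linarith
    also have "\<dots> = C ^ k * real (card (X \<union> Y))"
      unfolding card by (simp add: distrib_left)
    finally have "P (X \<union> Y)" using XB Y by (auto simp: P_def)
    from max[OF this] show False using card ne finY by (simp add: card_gt_0_iff)
  qed
  have "C ^ j * real (card (B - X)) \<le> real (card (set_power G A j <#> (B - X)))"
    by (rule plunnecke_growth[OF fin(1) _ sub(1) _ C jk top]) (use fin sub in auto)
  also have "card (set_power G A j <#> (B - X)) \<le> card (set_power G A j <#> B)"
    by (intro card_mono finite_set_mult finite_set_power fin sub) (auto simp: set_mult_def)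
  finally have "C ^ j * real (card (B - X)) \<le> real (card (set_power G A j <#> B))" by simp
  moreover have "real (card (B - X)) = real (card B) - real (card X)"
    using XB finX fin by (simp add: card_Diff_subset card_mono)
  ultimately show ?thesis using XB XP by auto
qed

end


section \<open>Almost invariant sets and averaging\<close>

lemma slow_growth_step:
  fixes u :: "nat \<Rightarrow> real"
  assumes "e \<ge> 0" "u N < (1 + e) ^ N * u 0"
  shows "\<exists>i<N. u (Suc i) \<le> (1 + e) * u i"
proof (rule ccontr)
  assume "\<not> ?thesis"
  then have fast: "(1 + e) * u i \<le> u (Suc i)" if "i < N" for i using that by force
  have "(1 + e) ^ n * u 0 \<le> u n" if "n \<le> N" for n
    using that
  proof (induction n)
    case (Suc n)
    have "(1 + e) ^ Suc n * u 0 = (1 + e) * ((1 + e) ^ n * u 0)" by simp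
    also have "\<dots> \<le> (1 + e) * u n" using Suc assms(1) by (intro mult_left_mono) auto
    also have "\<dots> \<le> u (Suc n)" using fast Suc.prems by simp
    finally show ?case .
  qed simp
  from this[of N] assms(2) show False by simp
qed

lemma polynomial_less_geometric:
  fixes e :: real
  assumes "e > 0"
  shows "\<exists>N. real ((N + 1) ^ d) < (1 + e) ^ N"
proof -
  define L where "L = ln (1 + e)"
  have L: "L > 0" using assms by (simp add: L_def)
  have "filterlim (\<lambda>n. L * real n) at_top sequentially"
    by (rule filterlim_tendsto_pos_mult_at_top[OF tendsto_const L filterlim_real_sequentially])
  from filterlim_compose[OF tendsto_power_div_exp_0 this]
  have "(\<lambda>n. (L * real n) ^ d / exp (L * real n)) \<longlonglongrightarrow> 0" .
  then have "(\<lambda>n. (L * real (Suc n)) ^ d / exp (L * real (Suc n))) \<longlonglongrightarrow> 0" by (rule LIMSEQ_Suc)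
  moreover have "0 < L ^ d / (1 + e)" using L assms by simp
  ultimately have "\<forall>\<^sub>F n in sequentially. (L * real (Suc n)) ^ d / exp (L * real (Suc n)) < L ^ d / (1 + e)"
    by (rule order_tendstoD)
  then obtain N where N: "(L * real (Suc N)) ^ d / exp (L * real (Suc N)) < L ^ d / (1 + e)"
    by (auto simp: eventually_sequentially)
  have "exp (L * real (Suc N)) = exp L ^ Suc N"
    by (simp only: exp_of_nat_mult[symmetric] mult.commute)
  also have "exp L = 1 + e" using assms by (simp add: L_def)
  finally have E: "exp (L * real (Suc N)) = (1 + e) ^ Suc N" .
  have "(L * real (Suc N)) ^ d = (L * real (Suc N)) ^ d / exp (L * real (Suc N)) * (1 + e) ^ Suc N"
    unfolding E using assms by simp
  also have "\<dots> < L ^ d / (1 + e) * (1 + e) ^ Suc N"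
    using N assms by (intro mult_strict_right_mono) auto
  also have "\<dots> = L ^ d * (1 + e) ^ N" using assms by simp
  finally have "L ^ d * real (Suc N) ^ d < L ^ d * (1 + e) ^ N"
    by (simp only: power_mult_distrib)
  then have "real ((N + 1) ^ d) < (1 + e) ^ N" using L by simp
  then show ?thesis ..
qed

context comm_group
begin

lemma l_coset_image: "g <# F = (\<lambda>x. g \<otimes> x) ` F"
  by (auto simp: l_coset_def)

lemma inj_on_translate: "g \<in> carrier G \<Longrightarrow> F \<subseteq> carrier G \<Longrightarrow> inj_on (\<lambda>x. g \<otimes> x) F"
  by (rule inj_onI) (auto simp: subset_iff)

lemma card_l_coset: "g \<in> carrier G \<Longrightarrow> F \<subseteq> carrier G \<Longrightarrow> card (g <# F) = card F"
  by (simp add: l_coset_image card_image inj_on_translate)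

lemma finite_l_coset: "finite F \<Longrightarrow> finite (g <# F)"
  by (simp add: l_coset_image)

lemma card_l_coset_Diff_swap:
  assumes "g \<in> carrier G" "finite F" "F \<subseteq> carrier G"
  shows "card (F - (g <# F)) = card ((g <# F) - F)"
  using card_l_coset[OF assms(1,3)] assms(2) finite_l_coset[OF assms(2), of g]
  by (metis card_le_sym_Diff le_antisym order_refl)

text \<open>
The defect \<open>g F - F\<close> is measured on one side only; by \<open>card_l_coset_Diff_swap\<close> the other side has the
same size.
\<close>
definition almost_invariant :: "'a set \<Rightarrow> real \<Rightarrow> 'a set \<Rightarrow> bool" where
  "almost_invariant E e F \<longleftrightarrow> finite F \<and> F \<noteq> {} \<and> F \<subseteq> carrier G \<and>
     (\<forall>g\<in>E. real (card ((g <# F) - F)) \<le> e * real (card F))"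

lemma almost_invariantD:
  assumes "almost_invariant E e F"
  shows "finite F" "F \<noteq> {}" "F \<subseteq> carrier G" "0 < card F"
    "g \<in> E \<Longrightarrow> real (card ((g <# F) - F)) \<le> e * real (card F)"
  using assms by (auto simp: almost_invariant_def card_gt_0_iff)

lemma almost_invariant_mono:
  assumes "almost_invariant E' e' F" "E \<subseteq> E'" "e' \<le> e"
  shows "almost_invariant E e F"
  unfolding almost_invariant_def
proof (intro conjI ballI)
  fix g assume "g \<in> E"
  then have "real (card ((g <# F) - F)) \<le> e' * real (card F)"
    using almost_invariantD(5)[OF assms(1)] assms(2) by blast
  also have "\<dots> \<le> e * real (card F)" using assms(3) by (simp add: mult_right_mono)
  finally show "real (card ((g <# F) - F)) \<le> e * real (card F)" .
qed (use almost_invariantD[OF assms(1)] in auto)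

lemma almost_invariant_l_coset:
  assumes "almost_invariant E e F" "E \<subseteq> carrier G" "g \<in> carrier G"
  shows "almost_invariant E e (g <# F)"
  unfolding almost_invariant_def
proof (intro conjI ballI)
  note F = almost_invariantD[OF assms(1)]
  show "g <# F \<subseteq> carrier G" using F assms by (intro l_coset_subset_G) auto
  fix h assume h: "h \<in> E"
  then have hG: "h \<in> carrier G" using assms by auto
  have "h <# (g <# F) = g <# (h <# F)"
    using F(3) hG assms(3) by (force simp: l_coset_image image_image m_lcomm intro!: image_cong)
  then have "(h <# (g <# F)) - (g <# F) = g <# ((h <# F) - F)"
    using inj_on_image_set_diff[OF inj_on_translate[OF assms(3), of "carrier G"], of "h <# F" F]
      F(3) l_coset_subset_G[OF F(3) hG] by (simp add: l_coset_image) blast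
  moreover have "(h <# F) - F \<subseteq> carrier G" using l_coset_subset_G[OF F(3) hG] by blast
  ultimately have "card ((h <# (g <# F)) - (g <# F)) = card ((h <# F) - F)"
    by (simp add: card_l_coset assms(3))
  then show "real (card ((h <# (g <# F)) - (g <# F))) \<le> e * real (card (g <# F))"
    using F(5)[OF h] F(3) assms(3) by (simp add: card_l_coset)
qed (use almost_invariantD[OF assms(1)] in \<open>auto simp: l_coset_image\<close>)

lemma card_set_mult_Diff_le:
  assumes "almost_invariant E e F" "finite E"
  shows "real (card ((E <#> F) - F)) \<le> real (card E) * (e * real (card F))"
proof -
  have eq: "(E <#> F) - F = (\<Union>g\<in>E. (g <# F) - F)"
    by (auto simp: set_mult_def l_coset_def)
  have "card ((E <#> F) - F) \<le> (\<Sum>g\<in>E. card ((g <# F) - F))"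
    unfolding eq by (rule card_UN_le[OF assms(2)])
  then have "real (card ((E <#> F) - F)) \<le> (\<Sum>g\<in>E. real (card ((g <# F) - F)))"
    by (metis of_nat_le_iff of_nat_sum)
  also have "\<dots> \<le> (\<Sum>g\<in>E. e * real (card F))"
    by (intro sum_mono almost_invariantD(5)[OF assms(1)])
  finally show ?thesis by simp
qed

lemma set_power_le_Suc:
  assumes "E \<subseteq> carrier G" "\<one> \<in> E"
  shows "set_power G E n \<subseteq> set_power G E (Suc n)"
proof
  fix x assume x: "x \<in> set_power G E n"
  then have "x \<in> carrier G" using set_power_subset_carrier[OF assms(1)] by blast
  then show "x \<in> set_power G E (Suc n)"
    using set_mult_memI[OF x assms(2)] by (simp add: set_power_Suc[OF assms(1)] del: set_power.simps)
qed

text \<open>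
By commutativity, a product of \<open>n\<close> factors from \<open>insert g E\<close> is \<open>g^i\<close> times a product of factors from
\<open>E\<close> with \<open>i \<le> n\<close>, so each new generator costs a factor \<open>n + 1\<close>.
\<close>
lemma polynomial_growth:
  assumes "finite E" "E \<subseteq> carrier G"
  shows "\<exists>d. \<forall>n. card (set_power G (insert \<one> E) n) \<le> (n + 1) ^ d"
  using assms
proof (induction E rule: finite_induct)
  case empty
  have "set_power G {\<one>} n = {\<one>}" for n
    by (induction n) (simp_all add: set_power_Suc one_set_mult del: set_power.simps(2,3))
  then show ?case by (intro exI[of _ 0]) simp
next
  case (insert g E)
  define E1 where "E1 = insert \<one> E"
  have g: "g \<in> carrier G" and E1: "E1 \<subseteq> carrier G" "\<one> \<in> E1" "finite E1"
    using insert by (auto simp: E1_def)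
  have E2: "insert g E1 \<subseteq> carrier G" using g E1 by auto
  obtain d where d: "\<And>n. card (set_power G E1 n) \<le> (n + 1) ^ d"
    using insert by (auto simp: E1_def)
  have sub: "set_power G (insert g E1) n \<subseteq> (\<Union>i\<le>n. (g [^] i) <# set_power G E1 n)" for n
  proof (induction n)
    case 0
    then show ?case by (simp add: l_coset_def)
  next
    case (Suc n)
    show ?case
    proof
      fix z assume "z \<in> set_power G (insert g E1) (Suc n)"
      then obtain y a where ya: "y \<in> set_power G (insert g E1) n" "a \<in> insert g E1" "z = y \<otimes> a"
        by (auto simp: set_power_Suc[OF E2] set_mult_def simp del: set_power.simps)
      then obtain i x where ix: "i \<le> n" "x \<in> set_power G E1 n" "y = (g [^] i) \<otimes> x"
        using Suc by (auto simp: l_coset_def)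
      have xG: "x \<in> carrier G" using ix set_power_subset_carrier[OF E1(1)] by blast
      consider "a = g" | "a \<in> E1" using ya by auto
      then show "z \<in> (\<Union>i\<le>Suc n. (g [^] i) <# set_power G E1 (Suc n))"
      proof cases
        case 1
        have "z = (g [^] Suc i) \<otimes> x" using ya ix 1 g xG by (simp add: m_ac)
        moreover have "x \<in> set_power G E1 (Suc n)" using ix set_power_le_Suc[OF E1(1,2)] by blast
        ultimately have "z \<in> (g [^] Suc i) <# set_power G E1 (Suc n)"
          unfolding l_coset_def by blast
        then show ?thesis using ix(1) by (meson UN_I atMost_iff Suc_le_mono)
      next
        case 2
        have "z = (g [^] i) \<otimes> (x \<otimes> a)" using ya ix 2 g xG E1 by (auto simp: m_assoc)
        moreover have "x \<otimes> a \<in> set_power G E1 (Suc n)"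
          using ix 2 by (auto simp: set_power_Suc[OF E1(1)] intro: set_mult_memI simp del: set_power.simps)
        ultimately have "z \<in> (g [^] i) <# set_power G E1 (Suc n)"
          unfolding l_coset_def by blast
        then show ?thesis using ix(1) by (meson UN_I atMost_iff le_SucI)
      qed
    qed
  qed
  have "card (set_power G (insert g E1) n) \<le> (n + 1) ^ Suc d" for n
  proof -
    have "card (set_power G (insert g E1) n) \<le> card (\<Union>i\<le>n. (g [^] i) <# set_power G E1 n)"
      by (rule card_mono[OF _ sub]) (auto intro!: finite_l_coset finite_set_power E1)
    also have "\<dots> \<le> (\<Sum>i\<le>n. card ((g [^] i) <# set_power G E1 n))" by (rule card_UN_le) simp
    also have "\<dots> = (n + 1) * card (set_power G E1 n)"
      using g by (simp add: card_l_coset set_power_subset_carrier[OF E1(1)])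
    also have "\<dots> \<le> (n + 1) * (n + 1) ^ d" using d by (rule mult_left_mono) simp
    finally show ?thesis by simp
  qed
  then have "\<forall>n. card (set_power G (insert \<one> (insert g E)) n) \<le> (n + 1) ^ Suc d"
    unfolding E1_def insert_commute[of g] by blast
  then show ?case ..
qed

text \<open>
Since the powers of \<open>E \<union> {\<one>}\<close> grow polynomially, some power grows by a factor of at most \<open>1 + e\<close>
in the next step, and that power is almost invariant.
\<close>
lemma almost_invariant_exists:
  assumes "finite E" "E \<subseteq> carrier G" "e > 0"
  shows "\<exists>F. almost_invariant E e F"
proof -
  define E1 where "E1 = insert \<one> E"
  have E1: "E1 \<subseteq> carrier G" "\<one> \<in> E1" "finite E1" using assms by (auto simp: E1_def)
  define u where "u n = real (card (set_power G E1 n))" for n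
  obtain d where d: "\<And>n. card (set_power G E1 n) \<le> (n + 1) ^ d"
    using polynomial_growth[OF assms(1,2)] by (auto simp: E1_def)
  obtain N where N: "real ((N + 1) ^ d) < (1 + e) ^ N" using polynomial_less_geometric[OF assms(3)] by blast
  have "u N \<le> real ((N + 1) ^ d)" unfolding u_def using d[of N] by (rule of_nat_mono)
  also have "\<dots> < (1 + e) ^ N * u 0" using N by (simp add: u_def)
  finally obtain i where i: "u (Suc i) \<le> (1 + e) * u i"
    using slow_growth_step[of e u N] assms(3) by auto
  let ?F = "set_power G E1 i"
  have sub: "?F \<subseteq> set_power G E1 (Suc i)" by (rule set_power_le_Suc[OF E1(1,2)])
  have fin: "finite (set_power G E1 n)" for n by (rule finite_set_power[OF E1(1,3)])
  have "\<one> \<in> set_power G E1 n" for n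
    by (induction n) (use set_power_le_Suc[OF E1(1,2)] in auto)
  then have ne: "?F \<noteq> {}" by blast
  have "real (card ((g <# ?F) - ?F)) \<le> e * real (card ?F)" if "g \<in> E" for g
  proof -
    have gF: "g <# ?F \<subseteq> set_power G E1 (Suc i)"
    proof
      fix z assume "z \<in> g <# ?F"
      then obtain x where x: "x \<in> ?F" "z = g \<otimes> x" by (auto simp: l_coset_def)
      have "g \<in> E1" using that by (simp add: E1_def)
      moreover have "x \<in> carrier G" using x set_power_subset_carrier[OF E1(1)] by blast
      ultimately have "z = x \<otimes> g" using x E1 by (auto simp: m_comm)
      then show "z \<in> set_power G E1 (Suc i)"
        using set_mult_memI[OF x(1) \<open>g \<in> E1\<close>] by (simp only: set_power_Suc[OF E1(1)])
    qed
    then have "card ((g <# ?F) - ?F) \<le> card (set_power G E1 (Suc i) - ?F)"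
      by (intro card_mono finite_Diff fin) auto
    also have "\<dots> = card (set_power G E1 (Suc i)) - card ?F"
      by (rule card_Diff_subset[OF fin sub])
    finally have "real (card ((g <# ?F) - ?F)) \<le> u (Suc i) - u i"
      using card_mono[OF fin sub] by (simp add: u_def)
    then show ?thesis using i by (simp add: u_def algebra_simps)
  qed
  then have "almost_invariant E e ?F"
    using fin ne set_power_subset_carrier[OF E1(1)] by (auto simp: almost_invariant_def)
  then show ?thesis ..
qed

lemma sum_card_l_coset_swap:
  assumes "finite H" "finite W" "H \<subseteq> carrier G" "W \<subseteq> carrier G"
  shows "(\<Sum>w\<in>W. card (D \<inter> (w <# H))) = (\<Sum>h\<in>H. card (D \<inter> (h <# W)))"
proof -
  have one: "card (D \<inter> (w <# H)) = (\<Sum>h\<in>H. if w \<otimes> h \<in> D then 1 else 0)"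
    if "w \<in> carrier G" "finite H" "H \<subseteq> carrier G" for w H
  proof -
    have "D \<inter> (w <# H) = w <# {h \<in> H. w \<otimes> h \<in> D}" by (auto simp: l_coset_def)
    then have "card (D \<inter> (w <# H)) = card {h \<in> H. w \<otimes> h \<in> D}"
      using that by (simp add: card_l_coset subset_iff)
    then show ?thesis using that(2) by (simp add: sum.inter_filter[symmetric])
  qed
  have "(\<Sum>w\<in>W. card (D \<inter> (w <# H))) = (\<Sum>w\<in>W. \<Sum>h\<in>H. if w \<otimes> h \<in> D then 1 else 0)"
    using assms by (intro sum.cong one) auto
  also have "\<dots> = (\<Sum>h\<in>H. \<Sum>w\<in>W. if w \<otimes> h \<in> D then 1 else 0)" by (rule sum.swap)
  also have "\<dots> = (\<Sum>h\<in>H. \<Sum>w\<in>W. if h \<otimes> w \<in> D then 1 else 0)"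
    using assms by (intro sum.cong refl) (auto simp: m_comm subset_iff)
  also have "\<dots> = (\<Sum>h\<in>H. card (D \<inter> (h <# W)))"
    using assms by (intro sum.cong refl one[symmetric]) auto
  finally show ?thesis .
qed

lemma card_Int_l_coset_diff:
  assumes "finite W" "W \<subseteq> carrier G" "h \<in> carrier G"
  shows "\<bar>real (card (D \<inter> (h <# W))) - real (card (D \<inter> W))\<bar> \<le> real (card ((h <# W) - W))"
proof -
  have fin: "finite (h <# W)" using assms by (simp add: finite_l_coset)
  have "card (D \<inter> (h <# W)) \<le> card ((D \<inter> W) \<union> ((h <# W) - W))"
    using assms fin by (intro card_mono) auto
  also have "\<dots> \<le> card (D \<inter> W) + card ((h <# W) - W)" by (rule card_Un_le)
  finally have a: "card (D \<inter> (h <# W)) \<le> card (D \<inter> W) + card ((h <# W) - W)" .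
  have "card (D \<inter> W) \<le> card ((D \<inter> (h <# W)) \<union> (W - (h <# W)))"
    using assms fin by (intro card_mono) auto
  also have "\<dots> \<le> card (D \<inter> (h <# W)) + card (W - (h <# W))" by (rule card_Un_le)
  also have "card (W - (h <# W)) = card ((h <# W) - W)"
    using assms by (intro card_l_coset_Diff_swap)
  finally show ?thesis using a by linarith
qed

text \<open>
The average of the density of \<open>D\<close> over the windows \<open>w H\<close> with \<open>w \<in> W\<close> equals its average over the
translates \<open>h W\<close> with \<open>h \<in> H\<close>, and the latter is close to the density of \<open>D\<close> in \<open>W\<close>. The error \<open>e\<close>
is additive, so the bound can also be used when the boundary of \<open>W\<close> is not small relative to \<open>W\<close>.
\<close>
lemma card_Int_le_of_translates:
  assumes H: "finite H" "H \<noteq> {}" "H \<subseteq> carrier G"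
    and W: "finite W" "W \<subseteq> carrier G"
    and m: "\<And>g. g \<in> W \<Longrightarrow> real (card (D \<inter> (g <# H))) \<le> m * real (card H)"
    and e: "\<And>h. h \<in> H \<Longrightarrow> real (card ((h <# W) - W)) \<le> e"
  shows "real (card (D \<inter> W)) \<le> m * real (card W) + e"
proof -
  have pos: "real (card H) > 0" using H by (simp add: card_gt_0_iff)
  have "real (card H) * (real (card (D \<inter> W)) - e) = (\<Sum>h\<in>H. real (card (D \<inter> W)) - e)" by simp
  also have "\<dots> \<le> (\<Sum>h\<in>H. real (card (D \<inter> (h <# W))))"
  proof (rule sum_mono)
    fix h assume "h \<in> H"
    then show "real (card (D \<inter> W)) - e \<le> real (card (D \<inter> (h <# W)))"
      using card_Int_l_coset_diff[OF W, of h D] e[of h] H(3) by auto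
  qed
  also have "\<dots> = (\<Sum>w\<in>W. real (card (D \<inter> (w <# H))))"
    using sum_card_l_coset_swap[OF H(1) W(1) H(3) W(2), of D] by (metis of_nat_sum)
  also have "\<dots> \<le> (\<Sum>w\<in>W. m * real (card H))" by (rule sum_mono) (rule m)
  also have "\<dots> = real (card H) * (m * real (card W))" by simp
  finally show ?thesis using pos by simp
qed

lemma card_compl_Int:
  assumes "finite Y" "Y \<subseteq> carrier G"
  shows "real (card ((carrier G - D) \<inter> Y)) = real (card Y) - real (card (D \<inter> Y))"
proof -
  have "(carrier G - D) \<inter> Y = Y - (D \<inter> Y)" using assms by auto
  then show ?thesis using assms by (simp add: card_Diff_subset card_mono)
qed

lemma card_Int_ge_of_translates:
  assumes H: "finite H" "H \<noteq> {}" "H \<subseteq> carrier G"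
    and W: "finite W" "W \<subseteq> carrier G"
    and m: "\<And>g. g \<in> W \<Longrightarrow> m * real (card H) \<le> real (card (D \<inter> (g <# H)))"
    and e: "\<And>h. h \<in> H \<Longrightarrow> real (card ((h <# W) - W)) \<le> e"
  shows "m * real (card W) - e \<le> real (card (D \<inter> W))"
proof -
  have "real (card ((carrier G - D) \<inter> W)) \<le> (1 - m) * real (card W) + e"
  proof (rule card_Int_le_of_translates[OF H W _ e])
    fix g assume g: "g \<in> W"
    then have "real (card ((carrier G - D) \<inter> (g <# H))) = real (card H) - real (card (D \<inter> (g <# H)))"
      using card_compl_Int[of "g <# H"] H W finite_l_coset l_coset_subset_G[OF H(3)] card_l_coset[OF _ H(3)] by auto
    then show "real (card ((carrier G - D) \<inter> (g <# H))) \<le> (1 - m) * real (card H)"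
      using m[OF g] by (simp add: algebra_simps)
  qed
  then show ?thesis using card_compl_Int[OF W, of D] by (simp add: algebra_simps)
qed

end


section \<open>Banach densities through finite windows\<close>

text \<open>
The upper limit is finite, so converting it to a real number loses nothing.
\<close>
lemma upper_density_bounds:
  assumes "\<And>n. finite (F n) \<and> F n \<noteq> {}"
  obtains r where "limsup (\<lambda>n. ereal (real (card (F n \<inter> D)) / real (card (F n)))) = ereal r"
    "upper_density F D = r"
proof -
  let ?x = "\<lambda>n. ereal (real (card (F n \<inter> D)) / real (card (F n)))"
  have "real (card (F n \<inter> D)) / real (card (F n)) \<le> 1" for n
    using assms[of n] by (auto simp: divide_le_eq_1 card_gt_0_iff intro!: card_mono)
  then have "limsup ?x \<le> ereal 1" by (intro Limsup_bounded always_eventually allI) simp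
  moreover have "ereal 0 \<le> limsup ?x" by (rule le_Limsup) (auto intro!: always_eventually)
  ultimately obtain r where "limsup ?x = ereal r" by (cases "limsup ?x") auto
  then show ?thesis using that by (simp add: upper_density_def)
qed

lemma upper_density_le:
  assumes "\<And>n. finite (F n) \<and> F n \<noteq> {}"
    and "\<forall>\<^sub>F n in sequentially. real (card (F n \<inter> D)) \<le> c * real (card (F n))"
  shows "upper_density F D \<le> c"
proof -
  obtain r where r: "limsup (\<lambda>n. ereal (real (card (F n \<inter> D)) / real (card (F n)))) = ereal r"
    "upper_density F D = r" by (rule upper_density_bounds[OF assms(1)])
  have "limsup (\<lambda>n. ereal (real (card (F n \<inter> D)) / real (card (F n)))) \<le> ereal c"
  proof (rule Limsup_bounded)
    show "\<forall>\<^sub>F n in sequentially. ereal (real (card (F n \<inter> D)) / real (card (F n))) \<le> ereal c"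
      using assms(2) by eventually_elim (use assms(1) in \<open>auto simp: pos_divide_le_eq card_gt_0_iff\<close>)
  qed
  then show ?thesis using r by simp
qed

lemma upper_density_ge:
  assumes "\<And>n. finite (F n) \<and> F n \<noteq> {}"
    and "\<forall>\<^sub>F n in sequentially. c * real (card (F n)) \<le> real (card (F n \<inter> D))"
  shows "c \<le> upper_density F D"
proof -
  obtain r where r: "limsup (\<lambda>n. ereal (real (card (F n \<inter> D)) / real (card (F n)))) = ereal r"
    "upper_density F D = r" by (rule upper_density_bounds[OF assms(1)])
  have "ereal c \<le> limsup (\<lambda>n. ereal (real (card (F n \<inter> D)) / real (card (F n))))"
  proof (rule le_Limsup)
    show "\<forall>\<^sub>F n in sequentially. ereal c \<le> ereal (real (card (F n \<inter> D)) / real (card (F n)))"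
      using assms(2) by eventually_elim (use assms(1) in \<open>auto simp: pos_le_divide_eq card_gt_0_iff\<close>)
  qed simp
  then show ?thesis using r by simp
qed

context comm_group
begin

lemma card_l_coset_Diff:
  assumes "g \<in> carrier G" "finite F" "F \<subseteq> carrier G"
  shows "real (card ((g <# F) - F)) = real (card F) - real (card (F \<inter> (g <# F)))"
proof -
  have fin: "finite (g <# F)" using assms by (simp add: finite_l_coset)
  have "(g <# F) - F = (g <# F) - (F \<inter> (g <# F))" by auto
  then have "card ((g <# F) - F) = card (g <# F) - card (F \<inter> (g <# F))"
    using assms(2) by (simp add: card_Diff_subset)
  moreover have "card (F \<inter> (g <# F)) \<le> card (g <# F)" using fin by (intro card_mono) auto
  ultimately show ?thesis using card_l_coset[OF assms(1,3)] by simp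
qed

lemma folner_sequence_finite:
  assumes "folner_sequence G F" shows "finite (F n) \<and> F n \<noteq> {}" "F n \<subseteq> carrier G"
  using assms by (auto simp: folner_sequence_def)

lemma folner_sequence_eventually_invariant:
  assumes F: "folner_sequence G F" and E: "finite E" "E \<subseteq> carrier G" and e: "e > 0"
  shows "\<forall>\<^sub>F n in sequentially. almost_invariant E e (F n)"
proof -
  note Ff = folner_sequence_finite[OF F]
  have "\<forall>\<^sub>F n in sequentially. real (card ((g <# F n) - F n)) \<le> e * real (card (F n))" if "g \<in> E" for g
  proof -
    have g: "g \<in> carrier G" using that E by auto
    then have "(\<lambda>n. real (card (F n \<inter> (g <# F n))) / real (card (F n))) \<longlonglongrightarrow> 1"
      using F by (auto simp: folner_sequence_def)
    then have "\<forall>\<^sub>F n in sequentially. 1 - e < real (card (F n \<inter> (g <# F n))) / real (card (F n))"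
      by (rule order_tendstoD) (use e in simp)
    then show ?thesis
    proof eventually_elim
      case (elim n)
      have "0 < real (card (F n))" using Ff(1)[of n] by (simp add: card_gt_0_iff)
      then have "(1 - e) * real (card (F n)) < real (card (F n \<inter> (g <# F n)))"
        using elim by (simp add: pos_less_divide_eq)
      then show ?case using card_l_coset_Diff[OF g, of "F n"] Ff by (simp add: left_diff_distrib)
    qed
  qed
  then have "\<forall>\<^sub>F n in sequentially. \<forall>g\<in>E. real (card ((g <# F n) - F n)) \<le> e * real (card (F n))"
    using E(1) by (simp add: eventually_ball_finite)
  then show ?thesis
    by eventually_elim (use Ff in \<open>simp add: almost_invariant_def\<close>)
qed

lemma folner_sequenceI:
  assumes fin: "\<And>n. finite (F n) \<and> F n \<noteq> {} \<and> F n \<subseteq> carrier G"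
    and inv: "\<And>g e. g \<in> carrier G \<Longrightarrow> e > 0 \<Longrightarrow> \<forall>\<^sub>F n in sequentially. almost_invariant {g} e (F n)"
  shows "folner_sequence G F"
  unfolding folner_sequence_def
proof (intro conjI allI ballI)
  fix g assume g: "g \<in> carrier G"
  have pos: "0 < real (card (F n))" for n using fin[of n] by (simp add: card_gt_0_iff)
  have le: "real (card (F n \<inter> (g <# F n))) / real (card (F n)) \<le> 1" for n
    using fin[of n] pos[of n] by (simp add: divide_le_eq_1_pos card_mono)
  show "(\<lambda>n. real (card (F n \<inter> (g <# F n))) / real (card (F n))) \<longlonglongrightarrow> 1"
  proof (rule order_tendstoI)
    fix a :: real assume a: "a < 1"
    then have "(1 - a) / 2 > 0" by simp
    from inv[OF g this]
    show "\<forall>\<^sub>F n in sequentially. a < real (card (F n \<inter> (g <# F n))) / real (card (F n))"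
    proof eventually_elim
      case (elim n)
      have "real (card (F n)) - real (card (F n \<inter> (g <# F n))) \<le> (1 - a) / 2 * real (card (F n))"
        using almost_invariantD(5)[OF elim] card_l_coset_Diff[OF g, of "F n"] fin by simp
      moreover have "(1 - a) / 2 * real (card (F n)) < (1 - a) * real (card (F n))"
        using a pos[of n] by (intro mult_strict_right_mono) auto
      ultimately have "a * real (card (F n)) < real (card (F n \<inter> (g <# F n)))"
        by (simp add: left_diff_distrib)
      then show ?case using pos[of n] by (simp add: pos_less_divide_eq)
    qed
  next
    fix a :: real assume "a > 1"
    then show "\<forall>\<^sub>F n in sequentially. real (card (F n \<inter> (g <# F n))) / real (card (F n)) < a"
      using le by (intro always_eventually allI) (meson le_less_trans)
  qed
qed (use fin in auto)

lemma folner_sequence_exists: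
  assumes "countable (carrier G)"
  shows "\<exists>F. folner_sequence G F"
proof -
  define E where "E n = from_nat_into (carrier G) ` {..n}" for n :: nat
  have ne: "carrier G \<noteq> {}" using one_closed by blast
  have E: "finite (E n)" "E n \<subseteq> carrier G" for n
    using from_nat_into[OF ne] by (auto simp: E_def)
  have "\<forall>n. \<exists>F. almost_invariant (E n) (1 / real (Suc n)) F"
    using almost_invariant_exists[OF E] by simp
  then obtain F where F: "\<And>n. almost_invariant (E n) (1 / real (Suc n)) (F n)" by metis
  have "folner_sequence G F"
  proof (rule folner_sequenceI)
    show "finite (F n) \<and> F n \<noteq> {} \<and> F n \<subseteq> carrier G" for n
      using almost_invariantD[OF F[of n]] by blast
    fix g and e :: real assume g: "g \<in> carrier G" and e: "e > 0"
    obtain m where m: "from_nat_into (carrier G) m = g"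
      using from_nat_into_surj[OF assms g] by blast
    obtain N where N: "1 / real (Suc N) < e" using e nat_approx_posE by metis
    show "\<forall>\<^sub>F n in sequentially. almost_invariant {g} e (F n)"
      unfolding eventually_sequentially
    proof (intro exI allI impI)
      fix n assume n: "max m N \<le> n"
      have "1 / real (Suc n) \<le> 1 / real (Suc N)" using n by (intro divide_left_mono) auto
      then show "almost_invariant {g} e (F n)"
        using m n N by (intro almost_invariant_mono[OF F[of n]]) (auto simp: E_def)
    qed
  qed
  then show ?thesis by blast
qed

lemma folner_sequence_l_coset:
  assumes F: "folner_sequence G F" and h: "\<And>n. h n \<in> carrier G"
  shows "folner_sequence G (\<lambda>n. h n <# F n)"
proof (rule folner_sequenceI)
  note Ff = folner_sequence_finite[OF F]
  show "finite (h n <# F n) \<and> h n <# F n \<noteq> {} \<and> h n <# F n \<subseteq> carrier G" for n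
    using Ff[of n] h l_coset_subset_G by (auto simp: l_coset_image)
  fix g and e :: real assume "g \<in> carrier G" "e > 0"
  then have "\<forall>\<^sub>F n in sequentially. almost_invariant {g} e (F n)"
    using folner_sequence_eventually_invariant[OF F, of "{g}" e] by simp
  then show "\<forall>\<^sub>F n in sequentially. almost_invariant {g} e (h n <# F n)"
    by eventually_elim (use \<open>g \<in> carrier G\<close> h in \<open>auto intro: almost_invariant_l_coset\<close>)
qed

text \<open>
The number \<open>\<alpha>\<close> is the infimum over \<open>H\<close> of the largest relative density of \<open>D\<close> in a translate of \<open>H\<close>.
The largest value exists because the cardinalities are bounded by \<open>card H\<close>.
\<close>
lemma extremal_translate_density:
  "\<exists>\<alpha>::real. (\<forall>H. finite H \<longrightarrow> H \<noteq> {} \<longrightarrow> H \<subseteq> carrier G \<longrightarrow>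
       (\<exists>g\<in>carrier G. \<alpha> * real (card H) \<le> real (card (D \<inter> (g <# H))))) \<and>
    (\<forall>\<eta>>0. \<exists>H. finite H \<and> H \<noteq> {} \<and> H \<subseteq> carrier G \<and>
       (\<forall>g\<in>carrier G. real (card (D \<inter> (g <# H))) \<le> (\<alpha> + \<eta>) * real (card H)))"
proof -
  define \<H> where "\<H> = {H. finite H \<and> H \<noteq> {} \<and> H \<subseteq> carrier G}"
  have "\<exists>g. g \<in> carrier G \<and> (\<forall>g'. g' \<in> carrier G \<longrightarrow> card (D \<inter> (g' <# H)) \<le> card (D \<inter> (g <# H)))"
    if "H \<in> \<H>" for H
  proof (rule ex_has_greatest_nat[where b = "Suc (card H)"])
    show "\<forall>g. g \<in> carrier G \<longrightarrow> card (D \<inter> (g <# H)) < Suc (card H)"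
      using that card_mono[OF finite_l_coset, of H] card_l_coset[of _ H]
      by (auto simp: \<H>_def less_Suc_eq_le) (metis Int_lower2)
  qed (rule one_closed)
  then obtain best where best: "\<And>H. H \<in> \<H> \<Longrightarrow> best H \<in> carrier G"
    "\<And>H g. H \<in> \<H> \<Longrightarrow> g \<in> carrier G \<Longrightarrow> card (D \<inter> (g <# H)) \<le> card (D \<inter> (best H <# H))"
    by metis
  define M where "M H = real (card (D \<inter> (best H <# H))) / real (card H)" for H
  have M0: "0 \<le> M H" for H by (simp add: M_def)
  have pos: "0 < real (card H)" if "H \<in> \<H>" for H using that by (auto simp: \<H>_def card_gt_0_iff)
  have ne: "\<H> \<noteq> {}" using one_closed by (auto simp: \<H>_def)
  have bdd: "bdd_below (M ` \<H>)" using M0 by (intro bdd_belowI2[of _ 0]) auto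
  show ?thesis
  proof (intro exI[of _ "Inf (M ` \<H>)"] conjI allI impI)
    fix H assume "finite H" "H \<noteq> {}" "H \<subseteq> carrier G"
    then have H: "H \<in> \<H>" by (simp add: \<H>_def)
    have "Inf (M ` \<H>) \<le> M H" using bdd H by (intro cInf_lower) auto
    then have "Inf (M ` \<H>) * real (card H) \<le> real (card (D \<inter> (best H <# H)))"
      using pos[OF H] by (simp add: M_def pos_le_divide_eq)
    then show "\<exists>g\<in>carrier G. Inf (M ` \<H>) * real (card H) \<le> real (card (D \<inter> (g <# H)))"
      using best(1)[OF H] by blast
  next
    fix \<eta> :: real assume "\<eta> > 0"
    then have "Inf (M ` \<H>) < Inf (M ` \<H>) + \<eta>" by simp
    then have "\<exists>x\<in>M ` \<H>. x < Inf (M ` \<H>) + \<eta>" using ne by (intro cInf_lessD) auto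
    then obtain H where H: "H \<in> \<H>" "M H < Inf (M ` \<H>) + \<eta>" by blast
    have "real (card (D \<inter> (g <# H))) \<le> (Inf (M ` \<H>) + \<eta>) * real (card H)" if "g \<in> carrier G" for g
    proof -
      have "real (card (D \<inter> (g <# H))) \<le> M H * real (card H)"
        using best(2)[OF H(1) that] pos[OF H(1)] by (simp add: M_def)
      also have "\<dots> \<le> (Inf (M ` \<H>) + \<eta>) * real (card H)" using H(2) by (intro mult_right_mono) auto
      finally show ?thesis .
    qed
    then show "\<exists>H. finite H \<and> H \<noteq> {} \<and> H \<subseteq> carrier G \<and>
        (\<forall>g\<in>carrier G. real (card (D \<inter> (g <# H))) \<le> (Inf (M ` \<H>) + \<eta>) * real (card H))"
      using H(1) by (auto simp: \<H>_def)
  qed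
qed

text \<open>
This is \<open>extremal_translate_density\<close> for the complement of \<open>D\<close>.
\<close>
lemma extremal_translate_density_lower:
  "\<exists>\<alpha>::real. (\<forall>H. finite H \<longrightarrow> H \<noteq> {} \<longrightarrow> H \<subseteq> carrier G \<longrightarrow>
       (\<exists>g\<in>carrier G. real (card (D \<inter> (g <# H))) \<le> \<alpha> * real (card H))) \<and>
    (\<forall>\<eta>>0. \<exists>H. finite H \<and> H \<noteq> {} \<and> H \<subseteq> carrier G \<and>
       (\<forall>g\<in>carrier G. (\<alpha> - \<eta>) * real (card H) \<le> real (card (D \<inter> (g <# H)))))"
proof -
  obtain \<alpha> where
    best: "\<forall>H. finite H \<longrightarrow> H \<noteq> {} \<longrightarrow> H \<subseteq> carrier G \<longrightarrow>
       (\<exists>g\<in>carrier G. \<alpha> * real (card H) \<le> real (card ((carrier G - D) \<inter> (g <# H))))"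
    and window: "\<forall>\<eta>>0. \<exists>H. finite H \<and> H \<noteq> {} \<and> H \<subseteq> carrier G \<and>
       (\<forall>g\<in>carrier G. real (card ((carrier G - D) \<inter> (g <# H))) \<le> (\<alpha> + \<eta>) * real (card H))"
    using extremal_translate_density[of "carrier G - D"] by blast
  note best = best[rule_format] and window = window[rule_format]
  have compl: "real (card ((carrier G - D) \<inter> (g <# H))) = real (card H) - real (card (D \<inter> (g <# H)))"
    if "finite H" "H \<subseteq> carrier G" "g \<in> carrier G" for g H
    using card_compl_Int[of "g <# H" D] that by (simp add: finite_l_coset l_coset_subset_G card_l_coset)
  show ?thesis
  proof (intro exI[of _ "1 - \<alpha>"] conjI allI impI)
    fix H assume H: "finite H" "H \<noteq> {}" "H \<subseteq> carrier G"
    show "\<exists>g\<in>carrier G. real (card (D \<inter> (g <# H))) \<le> (1 - \<alpha>) * real (card H)"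
    proof -
      obtain g where g: "g \<in> carrier G" "\<alpha> * real (card H) \<le> real (card ((carrier G - D) \<inter> (g <# H)))"
        using best[OF H] by blast
      have "real (card (D \<inter> (g <# H))) \<le> (1 - \<alpha>) * real (card H)"
        using g compl[OF H(1,3) g(1)] by (simp add: left_diff_distrib)
      then show ?thesis using g(1) by blast
    qed
  next
    fix \<eta> :: real assume "\<eta> > 0"
    from window[OF this] obtain H where H: "finite H" "H \<noteq> {}" "H \<subseteq> carrier G"
      "\<And>g. g \<in> carrier G \<Longrightarrow> real (card ((carrier G - D) \<inter> (g <# H))) \<le> (\<alpha> + \<eta>) * real (card H)" by blast
    then show "\<exists>H. finite H \<and> H \<noteq> {} \<and> H \<subseteq> carrier G \<and>
       (\<forall>g\<in>carrier G. (1 - \<alpha> - \<eta>) * real (card H) \<le> real (card (D \<inter> (g <# H))))"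
      using compl[OF H(1,3)] by (intro exI[of _ H]) (auto simp: algebra_simps)
  qed
qed

text \<open>
One finite window \<open>H\<close> bounds the density of \<open>D\<close> in every finite set \<open>W\<close>, up to the boundary of \<open>W\<close>
as seen by \<open>H\<close>. The error is kept separate from \<open>W\<close> because the bound is also applied to a
difference \<open>F - Z\<close>, whose boundary is small only compared with \<open>F\<close>.
\<close>
definition density_below :: "'a set \<Rightarrow> real \<Rightarrow> bool" where
  "density_below D m \<longleftrightarrow> (\<exists>H. finite H \<and> H \<subseteq> carrier G \<and>
     (\<forall>W e. finite W \<longrightarrow> W \<subseteq> carrier G \<longrightarrow> (\<forall>h\<in>H. real (card ((h <# W) - W)) \<le> e) \<longrightarrow>
        real (card (D \<inter> W)) \<le> m * real (card W) + e))"

definition density_above :: "'a set \<Rightarrow> real \<Rightarrow> bool" where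
  "density_above D m \<longleftrightarrow> (\<exists>H. finite H \<and> H \<subseteq> carrier G \<and>
     (\<forall>W e. finite W \<longrightarrow> W \<subseteq> carrier G \<longrightarrow> (\<forall>h\<in>H. real (card ((h <# W) - W)) \<le> e) \<longrightarrow>
        m * real (card W) - e \<le> real (card (D \<inter> W))))"

text \<open>
The window bound holds eventually along every Folner sequence, so no density exceeds \<open>\<alpha>\<close>. Replacing
each member of a Folner sequence by a translate of maximal density gives a Folner sequence along
which the density is \<open>\<alpha>\<close>, so the greatest element exists and equals \<open>\<alpha>\<close>.
\<close>
theorem upper_banach_density_characterization:
  assumes "countable (carrier G)"
  shows "finite H \<Longrightarrow> H \<noteq> {} \<Longrightarrow> H \<subseteq> carrier G \<Longrightarrow>
       \<exists>g\<in>carrier G. upper_banach_density G D * real (card H) \<le> real (card (D \<inter> (g <# H)))"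
    and "\<eta> > 0 \<Longrightarrow> density_below D (upper_banach_density G D + \<eta>)"
    and "0 \<le> upper_banach_density G D"
proof -
  obtain \<alpha> :: real where
    best: "\<forall>H. finite H \<longrightarrow> H \<noteq> {} \<longrightarrow> H \<subseteq> carrier G \<longrightarrow>
       (\<exists>g\<in>carrier G. \<alpha> * real (card H) \<le> real (card (D \<inter> (g <# H))))"
    and window: "\<forall>\<eta>>0. \<exists>H. finite H \<and> H \<noteq> {} \<and> H \<subseteq> carrier G \<and>
       (\<forall>g\<in>carrier G. real (card (D \<inter> (g <# H))) \<le> (\<alpha> + \<eta>) * real (card H))"
    using extremal_translate_density[of D] by blast
  note best = best[rule_format] and window = window[rule_format]
  have below: "density_below D (\<alpha> + \<eta>)" if \<eta>: "\<eta> > 0" for \<eta>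
  proof -
    obtain H where H: "finite H" "H \<noteq> {}" "H \<subseteq> carrier G"
      "\<And>g. g \<in> carrier G \<Longrightarrow> real (card (D \<inter> (g <# H))) \<le> (\<alpha> + \<eta>) * real (card H)"
      using window[OF \<eta>] by blast
    show ?thesis unfolding density_below_def
    proof (intro exI[of _ H] conjI allI impI H(1,3))
      fix W and e :: real assume W: "finite W" "W \<subseteq> carrier G" and
        e: "\<forall>h\<in>H. real (card ((h <# W) - W)) \<le> e"
      show "real (card (D \<inter> W)) \<le> (\<alpha> + \<eta>) * real (card W) + e"
        by (rule card_Int_le_of_translates[OF H(1-3) W]) (use H(4) W e in auto)
    qed
  qed
  have upper: "upper_density F D \<le> \<alpha>" if F: "folner_sequence G F" for F
  proof (rule field_le_epsilon)
    fix \<eta> :: real assume "\<eta> > 0"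
    then have \<eta>: "\<eta> / 2 > 0" by simp
    obtain H where H: "finite H" "H \<subseteq> carrier G"
      and bound: "\<forall>W e. finite W \<longrightarrow> W \<subseteq> carrier G \<longrightarrow> (\<forall>h\<in>H. real (card ((h <# W) - W)) \<le> e) \<longrightarrow>
        real (card (D \<inter> W)) \<le> (\<alpha> + \<eta> / 2) * real (card W) + e"
      using below[OF \<eta>] unfolding density_below_def by blast
    show "upper_density F D \<le> \<alpha> + \<eta>"
    proof (rule upper_density_le[OF folner_sequence_finite(1)[OF F]])
      show "\<forall>\<^sub>F n in sequentially. real (card (F n \<inter> D)) \<le> (\<alpha> + \<eta>) * real (card (F n))"
        using folner_sequence_eventually_invariant[OF F H(1,2) \<eta>]
      proof eventually_elim
        case (elim n)
        note W = almost_invariantD[OF elim]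
        have "\<forall>h\<in>H. real (card ((h <# F n) - F n)) \<le> \<eta> / 2 * real (card (F n))" using W(5) by blast
        from bound[THEN spec, THEN spec, THEN mp, THEN mp, THEN mp, OF W(1,3) this]
        show ?case by (simp add: Int_commute algebra_simps)
      qed
    qed
  qed
  obtain F where F: "folner_sequence G F" using folner_sequence_exists[OF assms] by blast
  note Ff = folner_sequence_finite[OF F]
  have "\<forall>n. \<exists>g\<in>carrier G. \<alpha> * real (card (F n)) \<le> real (card (D \<inter> (g <# F n)))"
    using best[OF conjunct1[OF Ff(1)] conjunct2[OF Ff(1)] Ff(2)] by (rule allI)
  then obtain h where h: "\<And>n. h n \<in> carrier G"
    "\<And>n. \<alpha> * real (card (F n)) \<le> real (card (D \<inter> (h n <# F n)))" by metis
  define F' where "F' n = h n <# F n" for n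
  have F': "folner_sequence G F'" unfolding F'_def by (rule folner_sequence_l_coset[OF F h(1)])
  have "\<alpha> \<le> upper_density F' D"
  proof (rule upper_density_ge[OF folner_sequence_finite(1)[OF F']], rule always_eventually, rule allI)
    show "\<alpha> * real (card (F' n)) \<le> real (card (F' n \<inter> D))" for n
      using h[of n] card_l_coset[OF h(1) Ff(2), of n] by (simp add: F'_def Int_commute)
  qed
  then have "upper_density F' D = \<alpha>" using upper[OF F'] by simp
  then have eq: "upper_banach_density G D = \<alpha>"
    unfolding upper_banach_density_def using F' upper
    by (intro Greatest_equality) auto
  show "\<exists>g\<in>carrier G. upper_banach_density G D * real (card H) \<le> real (card (D \<inter> (g <# H)))"
    if "finite H" "H \<noteq> {}" "H \<subseteq> carrier G" for H
    unfolding eq by (rule best[OF that])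
  show "density_below D (upper_banach_density G D + \<eta>)" if "\<eta> > 0" for \<eta>
    unfolding eq by (rule below[OF that])
  have "0 \<le> upper_density F D"
    by (rule upper_density_ge[OF Ff(1)]) (simp add: always_eventually)
  then show "0 \<le> upper_banach_density G D" using upper[OF F] eq by simp
qed

text \<open>
Dually, every Folner sequence has lower density at least \<open>\<alpha>\<close>, hence upper density at least \<open>\<alpha>\<close>, and
translates of minimal density give a Folner sequence whose upper density is \<open>\<alpha>\<close>.
\<close>
theorem lower_banach_density_characterization:
  assumes "countable (carrier G)"
  shows "finite H \<Longrightarrow> H \<noteq> {} \<Longrightarrow> H \<subseteq> carrier G \<Longrightarrow>
       \<exists>g\<in>carrier G. real (card (D \<inter> (g <# H))) \<le> lower_banach_density G D * real (card H)"
    and "\<eta> > 0 \<Longrightarrow> density_above D (lower_banach_density G D - \<eta>)"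
    and "0 \<le> lower_banach_density G D"
proof -
  obtain \<alpha> :: real where
    best: "\<forall>H. finite H \<longrightarrow> H \<noteq> {} \<longrightarrow> H \<subseteq> carrier G \<longrightarrow>
       (\<exists>g\<in>carrier G. real (card (D \<inter> (g <# H))) \<le> \<alpha> * real (card H))"
    and window: "\<forall>\<eta>>0. \<exists>H. finite H \<and> H \<noteq> {} \<and> H \<subseteq> carrier G \<and>
       (\<forall>g\<in>carrier G. (\<alpha> - \<eta>) * real (card H) \<le> real (card (D \<inter> (g <# H))))"
    using extremal_translate_density_lower[of D] by blast
  note best = best[rule_format] and window = window[rule_format]
  have above: "density_above D (\<alpha> - \<eta>)" if \<eta>: "\<eta> > 0" for \<eta>
  proof -
    obtain H where H: "finite H" "H \<noteq> {}" "H \<subseteq> carrier G"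
      "\<And>g. g \<in> carrier G \<Longrightarrow> (\<alpha> - \<eta>) * real (card H) \<le> real (card (D \<inter> (g <# H)))"
      using window[OF \<eta>] by blast
    show ?thesis unfolding density_above_def
    proof (intro exI[of _ H] conjI allI impI H(1,3))
      fix W and e :: real assume W: "finite W" "W \<subseteq> carrier G" and
        e: "\<forall>h\<in>H. real (card ((h <# W) - W)) \<le> e"
      show "(\<alpha> - \<eta>) * real (card W) - e \<le> real (card (D \<inter> W))"
        by (rule card_Int_ge_of_translates[OF H(1-3) W]) (use H(4) W e in auto)
    qed
  qed
  have lower: "\<alpha> \<le> upper_density F D" if F: "folner_sequence G F" for F
  proof (rule field_le_epsilon)
    fix \<eta> :: real assume "\<eta> > 0"
    then have \<eta>: "\<eta> / 2 > 0" by simp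
    obtain H where H: "finite H" "H \<subseteq> carrier G"
      and bound: "\<forall>W e. finite W \<longrightarrow> W \<subseteq> carrier G \<longrightarrow> (\<forall>h\<in>H. real (card ((h <# W) - W)) \<le> e) \<longrightarrow>
        (\<alpha> - \<eta> / 2) * real (card W) - e \<le> real (card (D \<inter> W))"
      using above[OF \<eta>] unfolding density_above_def by blast
    have "\<alpha> - \<eta> \<le> upper_density F D"
    proof (rule upper_density_ge[OF folner_sequence_finite(1)[OF F]])
      show "\<forall>\<^sub>F n in sequentially. (\<alpha> - \<eta>) * real (card (F n)) \<le> real (card (F n \<inter> D))"
        using folner_sequence_eventually_invariant[OF F H(1,2) \<eta>]
      proof eventually_elim
        case (elim n)
        note W = almost_invariantD[OF elim]
        have "\<forall>h\<in>H. real (card ((h <# F n) - F n)) \<le> \<eta> / 2 * real (card (F n))" using W(5) by blast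
        from bound[THEN spec, THEN spec, THEN mp, THEN mp, THEN mp, OF W(1,3) this]
        show ?case by (simp add: Int_commute algebra_simps)
      qed
    qed
    then show "\<alpha> \<le> upper_density F D + \<eta>" by simp
  qed
  obtain F where F: "folner_sequence G F" using folner_sequence_exists[OF assms] by blast
  note Ff = folner_sequence_finite[OF F]
  have "\<forall>n. \<exists>g\<in>carrier G. real (card (D \<inter> (g <# F n))) \<le> \<alpha> * real (card (F n))"
    using best[OF conjunct1[OF Ff(1)] conjunct2[OF Ff(1)] Ff(2)] by (rule allI)
  then obtain h where h: "\<And>n. h n \<in> carrier G"
    "\<And>n. real (card (D \<inter> (h n <# F n))) \<le> \<alpha> * real (card (F n))" by metis
  define F' where "F' n = h n <# F n" for n
  have F': "folner_sequence G F'" unfolding F'_def by (rule folner_sequence_l_coset[OF F h(1)])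
  have "upper_density F' D \<le> \<alpha>"
  proof (rule upper_density_le[OF folner_sequence_finite(1)[OF F']], rule always_eventually, rule allI)
    show "real (card (F' n \<inter> D)) \<le> \<alpha> * real (card (F' n))" for n
      using h[of n] card_l_coset[OF h(1) Ff(2), of n] by (simp add: F'_def Int_commute)
  qed
  then have ud: "upper_density F' D = \<alpha>" using lower[OF F'] by simp
  then have eq: "lower_banach_density G D = \<alpha>"
    unfolding lower_banach_density_def using F' lower
    by (intro Least_equality) auto
  show "\<exists>g\<in>carrier G. real (card (D \<inter> (g <# H))) \<le> lower_banach_density G D * real (card H)"
    if "finite H" "H \<noteq> {}" "H \<subseteq> carrier G" for H
    unfolding eq by (rule best[OF that])
  show "density_above D (lower_banach_density G D - \<eta>)" if "\<eta> > 0" for \<eta>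
    unfolding eq by (rule above[OF that])
  have "0 \<le> upper_density F' D"
    by (rule upper_density_ge[OF folner_sequence_finite(1)[OF F']]) (simp add: always_eventually)
  then show "0 \<le> lower_banach_density G D" using ud eq by simp
qed


section \<open>Simultaneous densities of two sets\<close>

lemma density_below_almost_invariant:
  assumes "density_below D m"
  shows "\<exists>H. finite H \<and> H \<subseteq> carrier G \<and>
    (\<forall>W e. almost_invariant H e W \<longrightarrow> real (card (D \<inter> W)) \<le> (m + e) * real (card W))"
proof -
  obtain H where H: "finite H" "H \<subseteq> carrier G"
    and bound: "\<forall>W e. finite W \<longrightarrow> W \<subseteq> carrier G \<longrightarrow> (\<forall>h\<in>H. real (card ((h <# W) - W)) \<le> e) \<longrightarrow>
        real (card (D \<inter> W)) \<le> m * real (card W) + e"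
    using assms unfolding density_below_def by blast
  show ?thesis
  proof (intro exI[of _ H] conjI H allI impI)
    fix W e assume inv: "almost_invariant H e W"
    note W = almost_invariantD[OF inv]
    have "\<forall>h\<in>H. real (card ((h <# W) - W)) \<le> e * real (card W)" using W(5) by blast
    from bound[THEN spec, THEN spec, THEN mp, THEN mp, THEN mp, OF W(1,3) this]
    show "real (card (D \<inter> W)) \<le> (m + e) * real (card W)" by (simp add: distrib_right)
  qed
qed

lemma density_above_almost_invariant:
  assumes "density_above D m"
  shows "\<exists>H. finite H \<and> H \<subseteq> carrier G \<and>
    (\<forall>W e. almost_invariant H e W \<longrightarrow> (m - e) * real (card W) \<le> real (card (D \<inter> W)))"
proof -
  obtain H where H: "finite H" "H \<subseteq> carrier G"
    and bound: "\<forall>W e. finite W \<longrightarrow> W \<subseteq> carrier G \<longrightarrow> (\<forall>h\<in>H. real (card ((h <# W) - W)) \<le> e) \<longrightarrow>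
        m * real (card W) - e \<le> real (card (D \<inter> W))"
    using assms unfolding density_above_def by blast
  show ?thesis
  proof (intro exI[of _ H] conjI H allI impI)
    fix W e assume inv: "almost_invariant H e W"
    note W = almost_invariantD[OF inv]
    have "\<forall>h\<in>H. real (card ((h <# W) - W)) \<le> e * real (card W)" using W(5) by blast
    from bound[THEN spec, THEN spec, THEN mp, THEN mp, THEN mp, OF W(1,3) this]
    show "(m - e) * real (card W) \<le> real (card (D \<inter> W))" by (simp add: left_diff_distrib)
  qed
qed

text \<open>
Pluennecke's inequality compares \<open>B\<close> and \<open>D = A^j B\<close> inside one finite set, so their densities have to
be controlled along the same almost invariant sets. With \<open>a\<close> fixed to an extremal density of \<open>D\<close>, the
admissible values of \<open>\<beta>\<close> are what the increment argument pushes up.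
\<close>
definition joint_density :: "'a set \<Rightarrow> 'a set \<Rightarrow> real \<Rightarrow> real \<Rightarrow> bool" where
  "joint_density D B a \<beta> \<longleftrightarrow> (\<forall>E e. finite E \<longrightarrow> E \<subseteq> carrier G \<longrightarrow> e > 0 \<longrightarrow>
     (\<exists>F. almost_invariant E e F \<and> real (card (D \<inter> F)) \<le> (a + e) * real (card F) \<and>
        (\<beta> - e) * real (card F) \<le> real (card (B \<inter> F))))"

text \<open>
The increment replaces \<open>F\<close> by a smaller set \<open>Z\<close>; this property keeps \<open>a\<close> unchanged in the process. It
expresses that \<open>a\<close> is extremal for \<open>D\<close>. The set \<open>Z\<close> is only almost contained in \<open>F\<close>, because it arises
from a subset of \<open>F\<close> by thickening.
\<close>
definition hereditary_density :: "'a set \<Rightarrow> real \<Rightarrow> bool" where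
  "hereditary_density D a \<longleftrightarrow> (\<forall>\<delta> \<epsilon>. \<delta> > 0 \<longrightarrow> \<epsilon> > 0 \<longrightarrow>
     (\<exists>E e. finite E \<and> E \<subseteq> carrier G \<and> e > 0 \<and>
       (\<forall>F Z. almost_invariant E e F \<longrightarrow> real (card (D \<inter> F)) \<le> (a + e) * real (card F) \<longrightarrow>
          almost_invariant E e Z \<longrightarrow> real (card (Z - F)) \<le> e * real (card F) \<longrightarrow>
          \<delta> * real (card F) \<le> real (card Z) \<longrightarrow>
          real (card (D \<inter> Z)) \<le> (a + \<epsilon>) * real (card Z))))"

lemma hereditary_upper_banach_density:
  assumes "countable (carrier G)"
  shows "hereditary_density D (upper_banach_density G D)"
  unfolding hereditary_density_def
proof (intro allI impI)
  fix \<delta> \<epsilon> :: real assume "\<delta> > 0" "\<epsilon> > 0"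
  let ?a = "upper_banach_density G D"
  have half: "\<epsilon> / 2 > 0" using \<open>\<epsilon> > 0\<close> by simp
  obtain H where H: "finite H" "H \<subseteq> carrier G"
    "\<forall>W e. almost_invariant H e W \<longrightarrow> real (card (D \<inter> W)) \<le> (?a + \<epsilon> / 2 + e) * real (card W)"
    using density_below_almost_invariant[OF upper_banach_density_characterization(2)[OF assms half, where D = D]] by blast
  have "real (card (D \<inter> Z)) \<le> (?a + \<epsilon>) * real (card Z)" if "almost_invariant H (\<epsilon> / 2) Z" for Z
    using H(3)[rule_format, OF that] by (simp add: add.assoc)
  then show "\<exists>E e. finite E \<and> E \<subseteq> carrier G \<and> e > 0 \<and>
       (\<forall>F Z. almost_invariant E e F \<longrightarrow> real (card (D \<inter> F)) \<le> (?a + e) * real (card F) \<longrightarrow>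
          almost_invariant E e Z \<longrightarrow> real (card (Z - F)) \<le> e * real (card F) \<longrightarrow>
          \<delta> * real (card F) \<le> real (card Z) \<longrightarrow>
          real (card (D \<inter> Z)) \<le> (?a + \<epsilon>) * real (card Z))"
    using H(1,2) half by (intro exI[of _ H] exI[of _ "\<epsilon> / 2"]) simp
qed

text \<open>
The density of \<open>D\<close> in \<open>F - Z\<close> is at least about \<open>a = d_*(D)\<close>, up to an error that is small compared
with \<open>F\<close>. As it is at most about \<open>a\<close> in \<open>F\<close>, it is at most about \<open>a\<close> in \<open>Z\<close>. Errors relative to \<open>F\<close> are
converted into errors relative to \<open>Z\<close> by the assumption \<open>\<delta> |F| \<le> |Z|\<close>.
\<close>
lemma hereditary_lower_banach_density:
  assumes "countable (carrier G)"
  shows "hereditary_density D (lower_banach_density G D)"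
  unfolding hereditary_density_def
proof (intro allI impI)
  fix \<delta> \<epsilon> :: real assume \<delta>: "\<delta> > 0" and \<epsilon>: "\<epsilon> > 0"
  define a where "a = lower_banach_density G D"
  have a0: "a \<ge> 0" unfolding a_def by (rule lower_banach_density_characterization(3)[OF assms])
  \<comment> \<open>The errors below add up to \<open>6 e |F|\<close>, which has to be at most \<open>\<epsilon> |Z|\<close>.\<close>
  define e where "e = min 1 (\<epsilon> * \<delta> / 6)"
  have e: "e > 0" "e \<le> 1" "6 * e \<le> \<epsilon> * \<delta>" using \<delta> \<epsilon> by (auto simp: e_def)
  obtain H where H: "finite H" "H \<subseteq> carrier G"
    and bound: "\<forall>W e'. finite W \<longrightarrow> W \<subseteq> carrier G \<longrightarrow> (\<forall>h\<in>H. real (card ((h <# W) - W)) \<le> e') \<longrightarrow>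
        (a - e) * real (card W) - e' \<le> real (card (D \<inter> W))"
    using lower_banach_density_characterization(2)[OF assms e(1), of D]
    unfolding density_above_def a_def by blast
  have "real (card (D \<inter> Z)) \<le> (a + \<epsilon>) * real (card Z)"
    if invF: "almost_invariant H e F" and DF: "real (card (D \<inter> F)) \<le> (a + e) * real (card F)"
      and invZ: "almost_invariant H e Z" and ZF: "real (card (Z - F)) \<le> e * real (card F)"
      and large: "\<delta> * real (card F) \<le> real (card Z)" for F Z
  proof -
    note F = almost_invariantD[OF invF] and Z = almost_invariantD[OF invZ]
    define W where "W = F - Z"
    have W: "finite W" "W \<subseteq> carrier G" using F by (auto simp: W_def)
    have "card Z \<le> card (F \<union> (Z - F))" using F Z by (intro card_mono) auto
    also have "\<dots> \<le> card F + card (Z - F)" by (rule card_Un_le)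
    finally have "real (card Z) \<le> real (card F) + e * real (card F)" using ZF by linarith
    also have "\<dots> \<le> real (card F) + 1 * real (card F)" using e by (intro add_left_mono mult_right_mono) auto
    finally have Z2: "real (card Z) \<le> 2 * real (card F)" by simp
    have bdry: "real (card ((h <# W) - W)) \<le> 3 * e * real (card F)" if h: "h \<in> H" for h
    proof -
      have hG: "h \<in> carrier G" using h H by auto
      have "(h <# W) - W \<subseteq> ((h <# F) - F) \<union> (Z - (h <# Z))"
      proof
        fix x assume "x \<in> (h <# W) - W"
        then obtain w where w: "w \<in> F" "w \<notin> Z" "x = h \<otimes> w" "x \<notin> W"
          by (auto simp: l_coset_def W_def)
        have "x \<notin> h <# Z"
          using w hG F(3) Z(3) by (auto simp: l_coset_def subset_iff)
        moreover have "x \<in> h <# F" using w by (auto simp: l_coset_def)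
        ultimately show "x \<in> ((h <# F) - F) \<union> (Z - (h <# Z))" using w(4) by (auto simp: W_def)
      qed
      then have "card ((h <# W) - W) \<le> card (((h <# F) - F) \<union> (Z - (h <# Z)))"
        using F Z by (intro card_mono) (auto simp: finite_l_coset)
      also have "\<dots> \<le> card ((h <# F) - F) + card (Z - (h <# Z))" by (rule card_Un_le)
      also have "card (Z - (h <# Z)) = card ((h <# Z) - Z)"
        by (rule card_l_coset_Diff_swap[OF hG Z(1,3)])
      finally have "real (card ((h <# W) - W)) \<le> e * real (card F) + e * real (card Z)"
        using F(5)[OF h] Z(5)[OF h] by linarith
      also have "e * real (card Z) \<le> e * (2 * real (card F))" using Z2 e by (intro mult_left_mono) auto
      finally show ?thesis by simp
    qed
    have "(a - e) * real (card W) - 3 * e * real (card F) \<le> real (card (D \<inter> W))"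
      using bound[THEN spec, THEN spec, THEN mp, THEN mp, THEN mp, OF W] bdry by blast
    moreover have "e * real (card W) \<le> e * real (card F)"
      using e F by (intro mult_left_mono) (auto simp: W_def intro: card_mono)
    moreover have "card F \<le> card W + card Z"
    proof -
      have "card F \<le> card (W \<union> Z)" using F Z W by (intro card_mono) (auto simp: W_def)
      then show ?thesis using card_Un_le[of W Z] by linarith
    qed
    then have "a * (real (card F) - real (card Z)) \<le> a * real (card W)"
      using a0 by (intro mult_left_mono) auto
    moreover have "card (D \<inter> Z) + card (D \<inter> W) \<le> card (D \<inter> F) + card (Z - F)"
    proof -
      have "card (D \<inter> Z) + card (D \<inter> W) = card ((D \<inter> Z) \<union> (D \<inter> W))"
        using Z W by (intro card_Un_disjoint[symmetric]) (auto simp: W_def)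
      also have "\<dots> \<le> card ((D \<inter> F) \<union> (Z - F))"
        using F Z by (intro card_mono) (auto simp: W_def)
      also have "\<dots> \<le> card (D \<inter> F) + card (Z - F)" by (rule card_Un_le)
      finally show ?thesis .
    qed
    ultimately have "real (card (D \<inter> Z)) \<le> a * real (card Z) + 6 * e * real (card F)"
      using DF ZF by (simp add: algebra_simps)
    also have "6 * e * real (card F) \<le> \<epsilon> * \<delta> * real (card F)" using e by (intro mult_right_mono) auto
    also have "\<dots> = \<epsilon> * (\<delta> * real (card F))" by simp
    also have "\<dots> \<le> \<epsilon> * real (card Z)" using large \<epsilon> by (intro mult_left_mono) auto
    finally show ?thesis by (simp add: algebra_simps)
  qed
  then show "\<exists>E e. finite E \<and> E \<subseteq> carrier G \<and> e > 0 \<and>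
       (\<forall>F Z. almost_invariant E e F \<longrightarrow>
          real (card (D \<inter> F)) \<le> (lower_banach_density G D + e) * real (card F) \<longrightarrow>
          almost_invariant E e Z \<longrightarrow> real (card (Z - F)) \<le> e * real (card F) \<longrightarrow>
          \<delta> * real (card F) \<le> real (card Z) \<longrightarrow>
          real (card (D \<inter> Z)) \<le> (lower_banach_density G D + \<epsilon>) * real (card Z))"
    using H e unfolding a_def[symmetric] by (intro exI[of _ H] exI[of _ e]) blast
qed

lemma joint_density_upper:
  assumes "countable (carrier G)"
  shows "joint_density D B (upper_banach_density G D) (upper_banach_density G B)"
  unfolding joint_density_def
proof (intro allI impI)
  fix E and e :: real assume E: "finite E" "E \<subseteq> carrier G" and e: "e > 0"
  let ?a = "upper_banach_density G D" and ?b = "upper_banach_density G B"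
  have half: "e / 2 > 0" using e by simp
  obtain H where H: "finite H" "H \<subseteq> carrier G"
    "\<forall>W e'. almost_invariant H e' W \<longrightarrow> real (card (D \<inter> W)) \<le> (?a + e / 2 + e') * real (card W)"
    using density_below_almost_invariant[OF upper_banach_density_characterization(2)[OF assms half, where D = D]] by blast
  have EH: "finite (E \<union> H)" "E \<union> H \<subseteq> carrier G" using E H by auto
  obtain F0 where F0: "almost_invariant (E \<union> H) (e / 2) F0"
    using almost_invariant_exists[OF EH half] by blast
  obtain g where g: "g \<in> carrier G" "?b * real (card F0) \<le> real (card (B \<inter> (g <# F0)))"
    using upper_banach_density_characterization(1)[OF assms almost_invariantD(1-3)[OF F0]] by blast
  have F: "almost_invariant (E \<union> H) (e / 2) (g <# F0)"
    by (rule almost_invariant_l_coset[OF F0 EH(2) g(1)])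
  have card: "card (g <# F0) = card F0" using card_l_coset[OF g(1) almost_invariantD(3)[OF F0]] .
  have "almost_invariant E e (g <# F0)" by (rule almost_invariant_mono[OF F]) (use e in auto)
  moreover have "almost_invariant H (e / 2) (g <# F0)" by (rule almost_invariant_mono[OF F]) auto
  then have "real (card (D \<inter> (g <# F0))) \<le> (?a + e) * real (card (g <# F0))"
    using H(3)[rule_format, of "e / 2" "g <# F0"] by (simp add: algebra_simps)
  moreover have "(?b - e) * real (card (g <# F0)) \<le> ?b * real (card (g <# F0))"
    using e by (intro mult_right_mono) auto
  ultimately show "\<exists>F. almost_invariant E e F \<and> real (card (D \<inter> F)) \<le> (?a + e) * real (card F) \<and>
        (?b - e) * real (card F) \<le> real (card (B \<inter> F))"
    using g(2) unfolding card by (intro exI[of _ "g <# F0"]) (simp add: card)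
qed

lemma joint_density_lower:
  assumes "countable (carrier G)"
  shows "joint_density D B (lower_banach_density G D) (lower_banach_density G B)"
  unfolding joint_density_def
proof (intro allI impI)
  fix E and e :: real assume E: "finite E" "E \<subseteq> carrier G" and e: "e > 0"
  let ?a = "lower_banach_density G D" and ?b = "lower_banach_density G B"
  have half: "e / 2 > 0" using e by simp
  obtain H where H: "finite H" "H \<subseteq> carrier G"
    "\<forall>W e'. almost_invariant H e' W \<longrightarrow> (?b - e / 2 - e') * real (card W) \<le> real (card (B \<inter> W))"
    using density_above_almost_invariant[OF lower_banach_density_characterization(2)[OF assms half, where D = B]] by blast
  have EH: "finite (E \<union> H)" "E \<union> H \<subseteq> carrier G" using E H by auto
  obtain F0 where F0: "almost_invariant (E \<union> H) (e / 2) F0"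
    using almost_invariant_exists[OF EH half] by blast
  obtain g where g: "g \<in> carrier G" "real (card (D \<inter> (g <# F0))) \<le> ?a * real (card F0)"
    using lower_banach_density_characterization(1)[OF assms almost_invariantD(1-3)[OF F0]] by blast
  have F: "almost_invariant (E \<union> H) (e / 2) (g <# F0)"
    by (rule almost_invariant_l_coset[OF F0 EH(2) g(1)])
  have card: "card (g <# F0) = card F0" using card_l_coset[OF g(1) almost_invariantD(3)[OF F0]] .
  have "almost_invariant E e (g <# F0)" by (rule almost_invariant_mono[OF F]) (use e in auto)
  moreover have "almost_invariant H (e / 2) (g <# F0)" by (rule almost_invariant_mono[OF F]) auto
  then have "(?b - e) * real (card (g <# F0)) \<le> real (card (B \<inter> (g <# F0)))"
    using H(3)[rule_format, of "e / 2" "g <# F0"] by (simp add: algebra_simps)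
  moreover have "?a * real (card (g <# F0)) \<le> (?a + e) * real (card (g <# F0))"
    using e by (intro mult_right_mono) auto
  ultimately show "\<exists>F. almost_invariant E e F \<and> real (card (D \<inter> F)) \<le> (?a + e) * real (card F) \<and>
        (?b - e) * real (card F) \<le> real (card (B \<inter> F))"
    using g(2) unfolding card by (intro exI[of _ "g <# F0"]) (simp add: card)
qed

lemma finite_subset_set_power:
  assumes "finite T" "T \<subseteq> set_power G A n" "A \<subseteq> carrier G"
  shows "\<exists>A'. finite A' \<and> A' \<subseteq> A \<and> T \<subseteq> set_power G A' n"
proof -
  have single: "\<exists>A'. finite A' \<and> A' \<subseteq> A \<and> x \<in> set_power G A' n" if "x \<in> set_power G A n" for x
    using that
  proof (induction n arbitrary: x)
    case 0
    then show ?case by (intro exI[of _ "{}"]) simp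
  next
    case (Suc n)
    then obtain y b where yb: "y \<in> set_power G A n" "b \<in> A" "x = y \<otimes> b"
      by (auto simp: set_power_Suc[OF assms(3)] set_mult_def simp del: set_power.simps)
    obtain A' where A': "finite A'" "A' \<subseteq> A" "y \<in> set_power G A' n" using Suc.IH[OF yb(1)] by blast
    have sub: "insert b A' \<subseteq> carrier G" using A' yb assms(3) by auto
    have "y \<in> set_power G (insert b A') n" using A'(3) set_power_mono[of A' "insert b A'" n] sub by blast
    then have "x \<in> set_power G (insert b A') (Suc n)"
      using yb(3) unfolding set_power_Suc[OF sub] by (auto intro: set_mult_memI)
    then show ?case using A' yb by (intro exI[of _ "insert b A'"]) simp
  qed
  show ?thesis using assms(1,2)
  proof (induction T rule: finite_induct)
    case empty
    then show ?case by blast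
  next
    case (insert x T)
    then obtain A1 where A1: "finite A1" "A1 \<subseteq> A" "T \<subseteq> set_power G A1 n" by auto
    obtain A2 where A2: "finite A2" "A2 \<subseteq> A" "x \<in> set_power G A2 n"
      using single[of x] insert.prems by blast
    have "A1 \<union> A2 \<subseteq> carrier G" using A1 A2 assms(3) by auto
    then have "insert x T \<subseteq> set_power G (A1 \<union> A2) n"
      using A1(3) A2(3) set_power_mono[of A1 "A1 \<union> A2" n] set_power_mono[of A2 "A1 \<union> A2" n] by auto
    then show ?case using A1 A2 by (intro exI[of _ "A1 \<union> A2"]) simp
  qed
qed

lemma dense_window_exists:
  assumes "countable (carrier G)" "finite E" "E \<subseteq> carrier G" "e > 0"
  shows "\<exists>H. almost_invariant E e H \<and> upper_banach_density G D * real (card H) \<le> real (card (D \<inter> H))"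
proof -
  obtain H0 where H0: "almost_invariant E e H0" using almost_invariant_exists[OF assms(2-4)] by blast
  obtain g where g: "g \<in> carrier G"
    "upper_banach_density G D * real (card H0) \<le> real (card (D \<inter> (g <# H0)))"
    using upper_banach_density_characterization(1)[OF assms(1) almost_invariantD(1-3)[OF H0]] by blast
  then show ?thesis
    using almost_invariant_l_coset[OF H0 assms(3) g(1)] card_l_coset[OF g(1) almost_invariantD(3)[OF H0]]
    by auto
qed

text \<open>
For \<open>z = s x\<close> with \<open>s \<in> E\<close> and \<open>x \<in> X\<close>, the window \<open>z H\<close> is almost the window \<open>x H\<close>, as \<open>H\<close> is
almost invariant under \<open>s\<close>; and \<open>x H\<close> meets \<open>K X\<close> at least in \<open>(K \<inter> H) x\<close>. So \<open>K X\<close> has density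
at least about \<open>c\<close> in the window around every point of \<open>Z\<close>, and hence in \<open>Z\<close> itself.
\<close>
lemma card_set_mult_ge_of_windows:
  assumes K: "finite K" "K \<subseteq> carrier G" and X: "finite X" "X \<subseteq> carrier G"
    and E: "finite E" "E \<subseteq> carrier G"
    and H: "almost_invariant E e H"
    and dense: "c * real (card H) \<le> real (card (K \<inter> H))"
    and Z: "Z = E <#> X" and inv: "almost_invariant H e Z"
  shows "(c - 2 * e) * real (card Z) \<le> real (card (K <#> X))"
proof -
  note H' = almost_invariantD[OF H] and Z' = almost_invariantD[OF inv]
  let ?Y = "carrier G - (K <#> X)"
  have "real (card (?Y \<inter> Z)) \<le> (1 - c + e) * real (card Z) + e * real (card Z)"
  proof (rule card_Int_le_of_translates[OF H'(1-3) Z'(1,3) _ Z'(5)])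
    fix z assume "z \<in> Z"
    then obtain s x where sx: "s \<in> E" "x \<in> X" "z = s \<otimes> x" unfolding Z by (rule set_mult_memE)
    have sG: "s \<in> carrier G" and xG: "x \<in> carrier G" using sx E X by auto
    have "?Y \<inter> (z <# H) \<subseteq> (x <# (H - K)) \<union> (x <# ((s <# H) - H))"
    proof
      fix y assume y: "y \<in> ?Y \<inter> (z <# H)"
      then obtain h where h: "h \<in> H" "y = z \<otimes> h" by (auto simp: l_coset_def)
      have hG: "h \<in> carrier G" using h H' by auto
      have y1: "y = x \<otimes> (s \<otimes> h)" using h sx sG xG hG by (simp add: m_ac)
      have y2: "y = (s \<otimes> h) \<otimes> x" using h sx sG xG hG by (simp add: m_ac)
      have "s \<otimes> h \<notin> K" using y y2 sx(2) by (auto intro: set_mult_memI)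
      moreover have "s \<otimes> h \<in> s <# H" using h by (auto simp: l_coset_def)
      ultimately show "y \<in> (x <# (H - K)) \<union> (x <# ((s <# H) - H))"
        using y1 by (auto simp: l_coset_def)
    qed
    then have "card (?Y \<inter> (z <# H)) \<le> card ((x <# (H - K)) \<union> (x <# ((s <# H) - H)))"
      using H' by (intro card_mono) (auto simp: finite_l_coset)
    also have "\<dots> \<le> card (x <# (H - K)) + card (x <# ((s <# H) - H))" by (rule card_Un_le)
    also have "\<dots> = card (H - K) + card ((s <# H) - H)"
      using card_l_coset[OF xG, of "H - K"] card_l_coset[OF xG, of "(s <# H) - H"]
        H'(3) l_coset_subset_G[OF H'(3) sG] by (simp add: subset_iff)
    finally have "real (card (?Y \<inter> (z <# H))) \<le> real (card (H - K)) + e * real (card H)"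
      using H'(5)[OF sx(1)] by linarith
    moreover have "real (card (H - K)) = real (card H) - real (card (K \<inter> H))"
    proof -
      have "H - K = H - (K \<inter> H)" by auto
      then show ?thesis using H'(1) by (simp add: card_Diff_subset card_mono)
    qed
    ultimately show "real (card (?Y \<inter> (z <# H))) \<le> (1 - c + e) * real (card H)"
      using dense by (simp add: algebra_simps)
  qed
  moreover have "real (card (?Y \<inter> Z)) = real (card Z) - real (card ((K <#> X) \<inter> Z))"
    by (rule card_compl_Int[OF Z'(1,3)])
  moreover have "card ((K <#> X) \<inter> Z) \<le> card (K <#> X)"
    using K X by (intro card_mono finite_set_mult) auto
  ultimately show ?thesis by (simp add: algebra_simps)
qed


section \<open>The density increment\<close>

text \<open>
The invariance required of \<open>F\<close> has to be fixed after the finite set \<open>A'\<close>, which depends on all the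
windows, which depend on the sets \<open>Es i\<close>. This is possible because the number \<open>N\<close> of steps after which
the pigeonhole principle applies depends only on the tolerance \<open>e1\<close>
and on the proportion \<open>\<delta>\<close> of \<open>F\<close> that \<open>X\<close> occupies at least.
\<close>
lemma density_increment:
  fixes C :: real
  assumes ctbl: "countable (carrier G)" and AB: "A \<subseteq> carrier G" "B \<subseteq> carrier G"
    and jk: "0 < j" "j < k"
    and hered: "hereditary_density (set_power G A j <#> B) a"
    and joint: "joint_density (set_power G A j <#> B) B a \<beta>"
    and C: "C > 0" and big: "a < C ^ j * \<beta>"
  shows "joint_density (set_power G A j <#> B) B a (upper_banach_density G (set_power G A k) / C ^ k)"
  unfolding joint_density_def
proof (intro allI impI)
  fix E and e :: real assume E: "finite E" "E \<subseteq> carrier G" and e: "e > 0"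
  let ?D = "set_power G A j <#> B" and ?K = "set_power G A k"
  define c where "c = upper_banach_density G ?K"
  \<comment> \<open>The exhaustion gives about \<open>(\<beta> - a / C^j) |F|\<close> elements of \<open>X\<close>; half of this absorbs the errors.\<close>
  define \<delta> where "\<delta> = (\<beta> - a / C ^ j) / 2"
  have Cj: "C ^ j > 0" and Ck: "C ^ k > 0" using C by simp_all
  have \<delta>: "\<delta> > 0" using big Cj by (simp add: \<delta>_def pos_divide_less_eq mult.commute)
  obtain E' e' where E': "finite E'" "E' \<subseteq> carrier G" and e': "e' > 0"
    and hereditary: "\<And>F Z. almost_invariant E' e' F \<Longrightarrow> real (card (?D \<inter> F)) \<le> (a + e') * real (card F) \<Longrightarrow>
          almost_invariant E' e' Z \<Longrightarrow> real (card (Z - F)) \<le> e' * real (card F) \<Longrightarrow>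
          \<delta> * real (card F) \<le> real (card Z) \<Longrightarrow> real (card (?D \<inter> Z)) \<le> (a + e) * real (card Z)"
    using hered[unfolded hereditary_density_def, rule_format, OF \<delta> e] by blast
  define e1 where "e1 = min e' (min e (e * C ^ k / 2))"
  have e1: "e1 > 0" "e1 \<le> e'" "e1 \<le> e" "2 * e1 \<le> e * C ^ k" using e e' Ck by (auto simp: e1_def)
  define E0 where "E0 = insert \<one> (E \<union> E')"
  have E0: "finite E0" "E0 \<subseteq> carrier G" using E E' by (auto simp: E0_def)
  have "\<exists>H. finite S \<longrightarrow> S \<subseteq> carrier G \<longrightarrow>
      almost_invariant S e1 H \<and> c * real (card H) \<le> real (card (?K \<inter> H))" for S
    using dense_window_exists[OF ctbl _ _ e1(1), of S ?K] by (auto simp: c_def)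
  then obtain win where win: "\<And>S. finite S \<Longrightarrow> S \<subseteq> carrier G \<Longrightarrow> almost_invariant S e1 (win S)"
    "\<And>S. finite S \<Longrightarrow> S \<subseteq> carrier G \<Longrightarrow> c * real (card (win S)) \<le> real (card (?K \<inter> win S))" by metis
  \<comment> \<open>Multiplying by \<open>win (Es i)\<close> makes slow growth from \<open>Es i X\<close> to \<open>Es (Suc i) X\<close> express invariance of \<open>Es i X\<close> under that window.\<close>
  define Es where "Es = rec_nat E0 (\<lambda>_ S. (E0 \<union> win S) <#> S)"
  have Es_0: "Es 0 = E0" and Es_Suc: "Es (Suc i) = (E0 \<union> win (Es i)) <#> Es i" for i
    by (simp_all add: Es_def)
  have Es: "finite (Es i) \<and> Es i \<subseteq> carrier G" for i
  proof (induction i)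
    case 0
    then show ?case using E0 by (simp add: Es_0)
  next
    case (Suc i)
    then have "almost_invariant (Es i) e1 (win (Es i))" using win(1) by blast
    then show ?case
      using Suc E0 almost_invariantD(1,3) unfolding Es_Suc
      by (metis finite_UnI finite_set_mult set_mult_closed Un_subset_iff)
  qed
  have Es_mono_Suc: "Es i \<subseteq> Es (Suc i)" for i
  proof
    fix x assume x: "x \<in> Es i"
    then have "x \<in> carrier G" using Es by blast
    moreover have "\<one> \<otimes> x \<in> Es (Suc i)"
      unfolding Es_Suc by (rule set_mult_memI) (use x in \<open>auto simp: E0_def\<close>)
    ultimately show "x \<in> Es (Suc i)" by simp
  qed
  have Es_mono: "Es i \<subseteq> Es l" if "i \<le> l" for i l
    using that Es_mono_Suc by (rule lift_Suc_mono_le[rotated])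
  have winD: "finite (win (Es i))" "win (Es i) \<subseteq> carrier G" "almost_invariant (Es i) e1 (win (Es i))" for i
    using win(1)[of "Es i"] Es[of i] almost_invariantD(1,3) by blast+
  obtain N where N: "2 / \<delta> < (1 + e1) ^ N" using real_arch_pow[of "1 + e1" "2 / \<delta>"] e1 by auto
  \<comment> \<open>Only finitely many elements of \<open>A^k\<close> are seen by the windows, so a finite part of \<open>A\<close> suffices.\<close>
  define T where "T = ?K \<inter> (\<Union>i<N. win (Es i))"
  have T: "finite T" "T \<subseteq> ?K" using winD by (auto simp: T_def)
  obtain A' where A': "finite A'" "A' \<subseteq> A" "T \<subseteq> set_power G A' k"
    using finite_subset_set_power[OF T AB(1)] by blast
  have A'G: "A' \<subseteq> carrier G" using A' AB by auto
  define J where "J = set_power G A' j"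
  have J: "finite J" "J \<subseteq> carrier G"
    using finite_set_power[OF A'G A'(1)] set_power_subset_carrier[OF A'G] by (auto simp: J_def)
  define r where "r = 1 + (1 + real (card J)) / C ^ j"
  have r: "r > 0" using Cj by (simp add: r_def add_pos_nonneg)
  \<comment> \<open>The three bounds serve the hereditary property of \<open>F\<close>, the size of \<open>X\<close>, and the size of \<open>Es N F - F\<close>.\<close>
  define e0 where "e0 = min e' (min (\<delta> / r) (min 1 e' / (1 + real (card (Es N)))))"
  have e0: "e0 > 0" "e0 \<le> e'" "e0 * r \<le> \<delta>" "real (card (Es N)) * e0 \<le> 1" "real (card (Es N)) * e0 \<le> e'"
  proof -
    have p: "0 < 1 + real (card (Es N))" by simp
    show "e0 > 0" using e' \<delta> r p by (simp add: e0_def)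
    show "e0 \<le> e'" by (simp add: e0_def)
    have "e0 \<le> \<delta> / r" by (simp add: e0_def)
    then show "e0 * r \<le> \<delta>" using r by (simp add: pos_le_divide_eq)
    have "e0 \<le> min 1 e' / (1 + real (card (Es N)))" by (simp add: e0_def)
    then have "e0 * (1 + real (card (Es N))) \<le> min 1 e'" using p by (simp add: pos_le_divide_eq)
    then have "real (card (Es N)) * e0 + e0 \<le> min 1 e'" by (simp add: algebra_simps)
    then show "real (card (Es N)) * e0 \<le> 1" "real (card (Es N)) * e0 \<le> e'" using \<open>e0 > 0\<close> by auto
  qed
  have "finite (Es N \<union> J)" "Es N \<union> J \<subseteq> carrier G" using Es[of N] J by auto
  then obtain F where F: "almost_invariant (Es N \<union> J) e0 F"
    and DF: "real (card (?D \<inter> F)) \<le> (a + e0) * real (card F)"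
    and BF: "(\<beta> - e0) * real (card F) \<le> real (card (B \<inter> F))"
    using joint e0(1) unfolding joint_density_def by blast
  note F' = almost_invariantD[OF F]
  have FN: "almost_invariant (Es N) e0 F" and FJ: "almost_invariant J e0 F"
    by (auto intro: almost_invariant_mono[OF F])
  have BFG: "finite (B \<inter> F)" "B \<inter> F \<subseteq> carrier G" using F' by auto
  obtain X where X: "X \<subseteq> B \<inter> F" and growth: "real (card (set_power G A' k <#> X)) \<le> C ^ k * real (card X)"
    and exhaust: "C ^ j * (real (card (B \<inter> F)) - real (card X)) \<le> real (card (J <#> (B \<inter> F)))"
    using plunnecke_exhaustion[OF A'(1) BFG(1) A'G BFG(2) C jk] unfolding J_def by blast
  have XG: "finite X" "X \<subseteq> carrier G" using X BFG finite_subset by blast+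
  have "J <#> (B \<inter> F) \<subseteq> (?D \<inter> F) \<union> ((J <#> F) - F)"
  proof -
    have "J <#> (B \<inter> F) \<subseteq> ?D"
      unfolding J_def by (rule mono_set_mult) (use set_power_mono[OF A'(2) AB(1)] in auto)
    moreover have "J <#> (B \<inter> F) \<subseteq> J <#> F" by (rule mono_set_mult) auto
    ultimately show ?thesis by blast
  qed
  then have "card (J <#> (B \<inter> F)) \<le> card ((?D \<inter> F) \<union> ((J <#> F) - F))"
    using F' J by (intro card_mono) (auto intro: finite_set_mult)
  also have "\<dots> \<le> card (?D \<inter> F) + card ((J <#> F) - F)" by (rule card_Un_le)
  finally have "real (card (J <#> (B \<inter> F))) \<le> (a + e0) * real (card F) + real (card J) * (e0 * real (card F))"
    using DF card_set_mult_Diff_le[OF FJ J(1)] by linarith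
  then have "C ^ j * (real (card (B \<inter> F)) - real (card X)) \<le> (a + e0 * (1 + real (card J))) * real (card F)"
    using exhaust by (simp add: algebra_simps)
  then have "real (card (B \<inter> F)) - real (card X) \<le> (a + e0 * (1 + real (card J))) * real (card F) / C ^ j"
    using Cj by (simp add: pos_le_divide_eq mult.commute)
  also have "\<dots> = (a / C ^ j + (e0 * r - e0)) * real (card F)"
    by (simp add: r_def add_divide_distrib distrib_left distrib_right)
  finally have "(\<beta> - e0) * real (card F) - (a / C ^ j + (e0 * r - e0)) * real (card F) \<le> real (card X)"
    using BF by linarith
  moreover have "(\<beta> - e0) * real (card F) - (a / C ^ j + (e0 * r - e0)) * real (card F)
      = (2 * \<delta> - e0 * r) * real (card F)" by (simp add: \<delta>_def algebra_simps)
  moreover have "\<delta> * real (card F) \<le> (2 * \<delta> - e0 * r) * real (card F)"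
    using e0(3) by (intro mult_right_mono) auto
  ultimately have XF: "\<delta> * real (card F) \<le> real (card X)" by linarith
  define u where "u i = real (card (Es i <#> X))" for i
  have XZ: "X \<subseteq> Es i <#> X" for i
  proof
    fix x assume x: "x \<in> X"
    have "\<one> \<in> Es i" using Es_mono[of 0 i] by (auto simp: Es_0 E0_def)
    from set_mult_memI[OF this x] show "x \<in> Es i <#> X" using x XG by auto
  qed
  have finZ: "finite (Es i <#> X)" for i using Es XG by (intro finite_set_mult) auto
  have Xu: "real (card X) \<le> u i" for i
    using card_mono[OF finZ XZ] by (simp add: u_def)
  have bdry: "real (card ((Es N <#> F) - F)) \<le> real (card (Es N)) * e0 * real (card F)"
    using card_set_mult_Diff_le[OF FN] Es[of N] by simp
  have sub_EF: "Es i <#> X \<subseteq> Es N <#> F" if "i \<le> N" for i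
    using X Es_mono[OF that] by (intro mono_set_mult) auto
  have "u N \<le> real (card (F \<union> ((Es N <#> F) - F)))"
    unfolding u_def using sub_EF[of N] F' Es[of N]
    by (intro of_nat_mono card_mono) (auto intro: finite_set_mult)
  also have "\<dots> \<le> real (card F) + real (card ((Es N <#> F) - F))"
    using card_Un_le[of F "(Es N <#> F) - F"] by linarith
  also have "\<dots> \<le> real (card F) + 1 * real (card F)"
    using bdry mult_right_mono[OF e0(4), of "real (card F)"] by linarith
  also have "\<dots> = 2 / \<delta> * (\<delta> * real (card F))" using \<delta> by simp
  also have "\<dots> < (1 + e1) ^ N * (\<delta> * real (card F))"
    using N \<delta> F'(4) by (intro mult_strict_right_mono) auto
  also have "\<dots> \<le> (1 + e1) ^ N * u 0"
    using XF Xu[of 0] e1 by (intro mult_left_mono) auto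
  finally obtain i where i: "i < N" "u (Suc i) \<le> (1 + e1) * u i"
    using slow_growth_step[of e1 u N] e1 by auto
  define Z where "Z = Es i <#> X"
  have ZG: "finite Z" "Z \<subseteq> carrier G" 
    using finZ set_mult_closed[OF _ XG(2), of "Es i"] Es[of i] unfolding Z_def by blast+
  have ZF: "\<delta> * real (card F) \<le> real (card Z)" using XF Xu[of i] by (simp add: Z_def u_def)
  have "0 < \<delta> * real (card F)" using \<delta> F'(4) by simp
  then have Zne: "Z \<noteq> {}" using ZF by auto
  have Z_sub: "Z \<subseteq> Es (Suc i) <#> X"
    unfolding Z_def by (rule mono_set_mult) (use Es_mono_Suc in auto)
  have invZ: "almost_invariant (E0 \<union> win (Es i)) e1 Z"
    unfolding almost_invariant_def
  proof (intro conjI ballI)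
    fix g assume g: "g \<in> E0 \<union> win (Es i)"
    have gG: "g \<in> carrier G" using g E0 winD by auto
    have "g <# Z \<subseteq> Es (Suc i) <#> X"
    proof
      fix z assume "z \<in> g <# Z"
      then obtain s x where sx: "s \<in> Es i" "x \<in> X" "z = g \<otimes> (s \<otimes> x)"
        by (auto simp: l_coset_def Z_def set_mult_def)
      have "s \<in> carrier G" "x \<in> carrier G" using sx Es[of i] XG by auto
      then have "z = (g \<otimes> s) \<otimes> x" using sx(3) gG by (simp add: m_assoc)
      moreover have "g \<otimes> s \<in> Es (Suc i)" unfolding Es_Suc by (rule set_mult_memI) (use g sx in auto)
      ultimately show "z \<in> Es (Suc i) <#> X" using sx by (auto intro: set_mult_memI)
    qed
    then have "card ((g <# Z) - Z) \<le> card ((Es (Suc i) <#> X) - Z)"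
      using finZ by (intro card_mono) auto
    also have "\<dots> = card (Es (Suc i) <#> X) - card Z" by (rule card_Diff_subset[OF ZG(1) Z_sub])
    finally have "real (card ((g <# Z) - Z)) \<le> u (Suc i) - u i"
      using card_mono[OF finZ Z_sub] by (simp add: u_def Z_def)
    also have "\<dots> \<le> e1 * u i" using i(2) by (simp add: algebra_simps)
    finally show "real (card ((g <# Z) - Z)) \<le> e1 * real (card Z)" by (simp add: u_def Z_def)
  qed (use ZG Zne in auto)
  have "almost_invariant E e Z" by (rule almost_invariant_mono[OF invZ]) (use e1 in \<open>auto simp: E0_def\<close>)
  moreover have "real (card (?D \<inter> Z)) \<le> (a + e) * real (card Z)"
  proof (rule hereditary[OF _ _ _ _ ZF])
    have "E' \<subseteq> Es N" using Es_mono[of 0 N] by (auto simp: Es_0 E0_def)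
    then show "almost_invariant E' e' F" by (rule almost_invariant_mono[OF FN]) (rule e0(2))
    have "(a + e0) * real (card F) \<le> (a + e') * real (card F)" using e0 by (intro mult_right_mono) auto
    then show "real (card (?D \<inter> F)) \<le> (a + e') * real (card F)" using DF by linarith
    show "almost_invariant E' e' Z" by (rule almost_invariant_mono[OF invZ]) (use e1 in \<open>auto simp: E0_def\<close>)
    have "real (card (Z - F)) \<le> real (card ((Es N <#> F) - F))"
      using sub_EF[of i] i F' Es[of N] unfolding Z_def
      by (intro of_nat_mono card_mono finite_Diff finite_set_mult) auto
    also have "\<dots> \<le> e' * real (card F)"
      using bdry mult_right_mono[OF e0(5), of "real (card F)"] by linarith
    finally show "real (card (Z - F)) \<le> e' * real (card F)" .
  qed
  moreover have "(c / C ^ k - e) * real (card Z) \<le> real (card (B \<inter> Z))"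
  proof -
    have "?K \<inter> win (Es i) \<subseteq> set_power G A' k \<inter> win (Es i)"
      using A'(3) i(1) by (auto simp: T_def)
    then have "card (?K \<inter> win (Es i)) \<le> card (set_power G A' k \<inter> win (Es i))"
      using winD by (intro card_mono) auto
    moreover have "c * real (card (win (Es i))) \<le> real (card (?K \<inter> win (Es i)))"
      using win(2)[of "Es i"] Es[of i] by blast
    ultimately have dense: "c * real (card (win (Es i))) \<le> real (card (set_power G A' k \<inter> win (Es i)))"
      by linarith
    have "almost_invariant (win (Es i)) e1 Z" by (rule almost_invariant_mono[OF invZ]) auto
    then have "(c - 2 * e1) * real (card Z) \<le> real (card (set_power G A' k <#> X))"
      using Es[of i]
      by (intro card_set_mult_ge_of_windows[OF finite_set_power[OF A'G A'(1)] set_power_subset_carrier[OF A'G]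
          XG _ _ winD(3) dense Z_def]) auto
    then have "(c - 2 * e1) * real (card Z) \<le> C ^ k * real (card X)" using growth by linarith
    moreover have "(c - e * C ^ k) * real (card Z) \<le> (c - 2 * e1) * real (card Z)"
      using e1(4) by (intro mult_right_mono) auto
    ultimately have "(c - e * C ^ k) * real (card Z) \<le> real (card X) * C ^ k" by (simp add: mult.commute)
    then have "(c - e * C ^ k) * real (card Z) / C ^ k \<le> real (card X)"
      using Ck by (simp add: pos_divide_le_eq)
    moreover have "(c - e * C ^ k) * real (card Z) / C ^ k = (c / C ^ k - e) * real (card Z)"
      using C by (simp add: field_simps)
    moreover have "card X \<le> card (B \<inter> Z)"
      using X XZ[of i] ZG by (intro card_mono) (auto simp: Z_def)
    ultimately show ?thesis by linarith
  qed
  ultimately show "\<exists>F. almost_invariant E e F \<and> real (card (?D \<inter> F)) \<le> (a + e) * real (card F) \<and>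
      (upper_banach_density G ?K / C ^ k - e) * real (card F) \<le> real (card (B \<inter> F))"
    unfolding c_def by blast
qed

lemma joint_density_le_1:
  assumes "joint_density D B a \<beta>"
  shows "\<beta> \<le> 1"
proof (rule field_le_epsilon)
  fix e :: real assume "e > 0"
  then obtain F where F: "almost_invariant {} e F" "(\<beta> - e) * real (card F) \<le> real (card (B \<inter> F))"
    using assms unfolding joint_density_def by (metis empty_subsetI finite.emptyI)
  have "card (B \<inter> F) \<le> card F" using almost_invariantD(1)[OF F(1)] by (intro card_mono) auto
  then have "(\<beta> - e) * real (card F) \<le> 1 * real (card F)" using F(2) by simp
  then have "\<beta> - e \<le> 1" using almost_invariantD(4)[OF F(1)] by (simp add: mult_le_cancel_right)
  then show "\<beta> \<le> 1 + e" by simp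
qed

text \<open>
The set of admissible \<open>\<beta>\<close> is closed, because the definition already contains an arbitrary error.
\<close>
lemma joint_density_Sup:
  assumes "joint_density D B a \<beta>0"
  defines "\<sigma> \<equiv> Sup {\<beta>. joint_density D B a \<beta>}"
  shows "joint_density D B a \<sigma>"
  unfolding joint_density_def
proof (intro allI impI)
  let ?S = "{\<beta>. joint_density D B a \<beta>}"
  fix E and e :: real assume E: "finite E" "E \<subseteq> carrier G" and e: "e > 0"
  have "\<exists>\<beta>\<in>?S. \<sigma> - e / 2 < \<beta>"
    unfolding \<sigma>_def by (rule less_cSupD) (use assms e in auto)
  then obtain \<beta> where \<beta>: "joint_density D B a \<beta>" "\<sigma> - e / 2 < \<beta>" by blast
  have half: "e / 2 > 0" using e by simp
  obtain F where F: "almost_invariant E (e / 2) F" "real (card (D \<inter> F)) \<le> (a + e / 2) * real (card F)"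
    "(\<beta> - e / 2) * real (card F) \<le> real (card (B \<inter> F))"
    using \<beta>(1)[unfolded joint_density_def, rule_format, OF E half] by blast
  have "almost_invariant E e F" by (rule almost_invariant_mono[OF F(1)]) (use e in auto)
  moreover have "(a + e / 2) * real (card F) \<le> (a + e) * real (card F)"
    using e by (intro mult_right_mono) auto
  moreover have "(\<sigma> - e) * real (card F) \<le> (\<beta> - e / 2) * real (card F)"
    using \<beta>(2) by (intro mult_right_mono) auto
  ultimately show "\<exists>F. almost_invariant E e F \<and> real (card (D \<inter> F)) \<le> (a + e) * real (card F) \<and>
      (\<sigma> - e) * real (card F) \<le> real (card (B \<inter> F))"
    using F(2,3) by (intro exI[of _ F]) auto
qed

text \<open>
If the inequality failed, it would also fail for the largest admissible \<open>\<beta>\<close> in place of \<open>\<beta>0\<close>. Then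
\<open>(a / \<beta>)^(1/j) < (c / \<beta>)^(1/k)\<close>, and for any \<open>C\<close> strictly in between the increment produces the
admissible value \<open>c / C^k > \<beta>\<close>.
\<close>
theorem plunnecke_joint_density:
  assumes ctbl: "countable (carrier G)" and AB: "A \<subseteq> carrier G" "B \<subseteq> carrier G"
    and jk: "0 < j" "j < k"
    and hered: "hereditary_density (set_power G A j <#> B) a"
    and joint: "joint_density (set_power G A j <#> B) B a \<beta>0"
    and nonneg: "0 \<le> a" "0 \<le> \<beta>0"
  shows "upper_banach_density G (set_power G A k) powr (real j / real k) * \<beta>0 powr (1 - real j / real k) \<le> a"
proof (rule ccontr)
  let ?D = "set_power G A j <#> B"
  define c where "c = upper_banach_density G (set_power G A k)"
  define \<theta> where "\<theta> = real j / real k"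
  have \<theta>: "0 < \<theta>" "\<theta> < 1" using jk by (auto simp: \<theta>_def)
  assume "\<not> ?thesis"
  then have less: "a < c powr \<theta> * \<beta>0 powr (1 - \<theta>)" by (simp add: c_def \<theta>_def)
  have c0: "0 \<le> c" unfolding c_def by (rule upper_banach_density_characterization(3)[OF ctbl])
  have "c \<noteq> 0" "\<beta>0 \<noteq> 0" using less nonneg by auto
  then have c: "c > 0" and \<beta>0: "\<beta>0 > 0" using c0 nonneg by auto
  define \<beta> where "\<beta> = Sup {\<beta>. joint_density ?D B a \<beta>}"
  have bdd: "bdd_above {\<beta>. joint_density ?D B a \<beta>}"
    by (rule bdd_aboveI[of _ 1]) (simp add: joint_density_le_1)
  have max: "\<beta>' \<le> \<beta>" if "joint_density ?D B a \<beta>'" for \<beta>'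
    unfolding \<beta>_def by (rule cSup_upper) (use that bdd in auto)
  have \<beta>: "\<beta> > 0" "\<beta>0 \<le> \<beta>" using max[OF joint] \<beta>0 by auto
  have joint\<beta>: "joint_density ?D B a \<beta>" unfolding \<beta>_def by (rule joint_density_Sup[OF joint])
  have "c powr \<theta> * \<beta>0 powr (1 - \<theta>) \<le> c powr \<theta> * \<beta> powr (1 - \<theta>)"
    using \<beta> \<beta>0 \<theta> by (intro mult_left_mono powr_mono2) auto
  also have "\<dots> = (c / \<beta>) powr \<theta> * \<beta>"
    using c \<beta> by (simp add: powr_divide powr_diff)
  finally have a_less: "a / \<beta> < (c / \<beta>) powr \<theta>" using less \<beta> by (simp add: pos_divide_less_eq)
  define L where "L = (a / \<beta>) powr (1 / real j)"
  define U where "U = (c / \<beta>) powr (1 / real k)"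
  have "L < ((c / \<beta>) powr \<theta>) powr (1 / real j)"
    unfolding L_def using a_less nonneg \<beta> jk by (intro powr_less_mono2) auto
  also have "\<dots> = U" using jk by (simp add: U_def powr_powr \<theta>_def)
  finally have LU: "L < U" .
  define C where "C = (L + U) / 2"
  have L0: "L \<ge> 0" by (simp add: L_def)
  have C: "C > 0" "L < C" "C < U" using L0 LU by (auto simp: C_def)
  have "a / \<beta> = L powr real j" using nonneg \<beta> jk by (simp add: L_def powr_powr)
  also have "\<dots> < C powr real j" using L0 C jk by (intro powr_less_mono2) auto
  also have "\<dots> = C ^ j" using C by (simp add: powr_realpow)
  finally have "a < C ^ j * \<beta>" using \<beta> by (simp add: pos_divide_less_eq)
  then have "c / C ^ k \<le> \<beta>"
    using max density_increment[OF ctbl AB jk hered joint\<beta> C(1)] by (simp add: c_def)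
  moreover have "C ^ k < c / \<beta>"
  proof -
    have "C ^ k = C powr real k" using C by (simp add: powr_realpow)
    also have "\<dots> < U powr real k" using C jk by (intro powr_less_mono2) auto
    also have "\<dots> = c / \<beta>" using c \<beta> jk by (simp add: U_def powr_powr)
    finally show ?thesis .
  qed
  ultimately show False using \<beta> C by (simp add: field_simps)
qed

end

theorem theorem1p3:
  fixes G :: "('a, 'b) monoid_scheme" and A B :: "'a set" and j k :: nat
  assumes "comm_group G" and "countable (carrier G)"
    and "A \<subseteq> carrier G" and "B \<subseteq> carrier G"
    and "0 < j" and "j < k"
  shows "upper_banach_density G (set_power G A j <#>\<^bsub>G\<^esub> B) \<ge>
           upper_banach_density G (set_power G A k) powr (real j / real k) *
           upper_banach_density G B powr (1 - real j / real k) \<and>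
         lower_banach_density G (set_power G A j <#>\<^bsub>G\<^esub> B) \<ge>
           upper_banach_density G (set_power G A k) powr (real j / real k) *
           lower_banach_density G B powr (1 - real j / real k)"
proof -
  interpret comm_group G by (rule assms(1))
  note upper = upper_banach_density_characterization(3)[OF assms(2)]
  note lower = lower_banach_density_characterization(3)[OF assms(2)]
  show ?thesis
    using plunnecke_joint_density[OF assms(2-6) hereditary_upper_banach_density[OF assms(2)]
        joint_density_upper[OF assms(2)] upper upper]
      plunnecke_joint_density[OF assms(2-6) hereditary_lower_banach_density[OF assms(2)]
        joint_density_lower[OF assms(2)] lower lower]
    by blast
qed

end
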